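(* Let $k$ and $n$ be positive integers. For $m\in\{0,1,2\}$, we have $$(-1)^{k}\left(C_m(n)-\sum_{j=1-k}^{k}(-1)^j\,u_m\big(n-j(3j-1)/2\big)\right)=\sum_{j=0}^{n}C_m(j)\,M_k(n-j).$$
   Context: Unimodal compositions. A composition of a positive integer $n$ is a sequence $(\lambda_1,\ldots,\lambda_r)$ of positive integers (parts) with sum $n$. It is unimodal if there exists $t\in\{1,\ldots,r\}$ with $\lambda_1\leqslant\cdots\leqslant\lambda_t$ and $\lambda_t\geqslant\cdots\geqslant\lambda_r$. For $n\geqslant 1$, $u_0(n)$ is the number of unimodal compositions of $n$, and $u_0(0)=0$. For $m\geqslant1$ and $n\geqslant0$, $u_m(n)$ is the number of unimodal compositions of $n+m$ in which the maximal part appears exactly $m$ times; in particular $u_m(0)=1$. Convention: $u_m(n)=0$ for $n<0$. Crank. For a partition $\lambda=(\lambda_1\geqslant\lambda_2\geqslant\cdots)$, let $\omega(\lambda)$ be the number of parts of $\lambda$ equal to $1$, and $\mu(\lambda)$ the number of parts of $\lambda$ larger than $\omega(\lambda)$. The crank is $c(\lambda)=\lambda_1$ (the largest part) if $\omega(\lambda)=0$, and $c(\lambda)=\mu(\lambda)-\omega(\lambda)$ if $\omega(\lambda)>0$. The empty partition of $0$ has crank $0$. For a non-negative integer $n\neq1$: $C_0(n)$ is the number of partitions $\lambda$ of $n$ with $c(\lambda)>0$; $C_1(n)$ is the number of partitions $\lambda$ of $n$ with $c(\lambda)\geqslant0$; $C_2(n)$ is the number of partitions $\lambda$ of $n$ with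 $c(\lambda)=0$. Thus $C_0(0)=0$ and $C_1(0)=C_2(0)=1$. Moreover, by definition, $C_0(1)=1$, $C_1(1)=0$, $C_2(1)=-1$. $M_k(n)$ (for $k\geqslant 1$, $n\geqslant 0$) is the number of partitions of $n$ in which $k$ is the least positive integer that is not a part and there are more parts $>k$ than there are parts $<k$ (parts counted with multiplicity); in particular $M_k(0)=0$. *)

theory Defs
  imports "HOL-Library.Multiset"
begin

section \<open>Unimodal compositions\<close>

definition compositions :: "nat \<Rightarrow> nat list set" where
  "compositions n = {xs. (\<forall>x\<in>set xs. 0 < x) \<and> sum_list xs = n}"

text \<open>Positions are counted from 1. The parts up to position \<open>t\<close> and the parts from position
  \<open>t\<close> on overlap in the part at position \<open>t\<close>. The empty list is not unimodal.\<close>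

definition unimodal :: "nat list \<Rightarrow> bool" where
  "unimodal xs \<longleftrightarrow>
     (\<exists>t\<in>{1..length xs}. sorted_wrt (\<le>) (take t xs) \<and> sorted_wrt (\<ge>) (drop (t - 1) xs))"

text \<open>\<open>unimodal_count m n\<close> is \<open>u\<^sub>m(n)\<close>; the argument \<open>n\<close> is an integer because \<open>u\<^sub>m\<close> is
  extended by \<open>0\<close> to negative arguments.\<close>

definition unimodal_count :: "nat \<Rightarrow> int \<Rightarrow> nat" where
  "unimodal_count m n =
     (if n < 0 then 0
      else if m = 0 then
        (if n = 0 then 0 else card {xs \<in> compositions (nat n). unimodal xs})
      else
        card {xs \<in> compositions (nat n + m). unimodal xs \<and> count_list xs (Max (set xs)) = m})"

section \<open>Partitions and the crank\<close>

text \<open>A partition is the multiset of its parts.\<close>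

definition partitions :: "nat \<Rightarrow> nat multiset set" where
  "partitions n = {p. (\<forall>x\<in>#p. 0 < x) \<and> sum_mset p = n}"

definition crank :: "nat multiset \<Rightarrow> int" where
  "crank p =
     (if p = {#} then 0
      else if count p 1 = 0 then int (Max (set_mset p))
      else int (size {#x \<in># p. count p 1 < x#}) - int (count p 1))"

text \<open>\<open>crank_count m n\<close> is \<open>C\<^sub>m(n)\<close>, which is only meaningful for \<open>m \<in> {0, 1, 2}\<close>; other \<open>m\<close>
  get the dummy value \<open>0\<close>. The values at \<open>n = 1\<close> are set by convention.\<close>

definition crank_count :: "nat \<Rightarrow> nat \<Rightarrow> int" where
  "crank_count m n =
     (if m = 0 then (if n = 1 then 1 else int (card {p \<in> partitions n. crank p > 0}))
      else if m = 1 then (if n = 1 then 0 else int (card {p \<in> partitions n. crank p \<ge> 0}))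
      else if m = 2 then (if n = 1 then - 1 else int (card {p \<in> partitions n. crank p = 0}))
      else 0)"

text \<open>\<open>mex_count k n\<close> is \<open>M\<^sub>k(n)\<close>.\<close>

definition mex_count :: "nat \<Rightarrow> nat \<Rightarrow> nat" where
  "mex_count k n =
     card {p \<in> partitions n. k = (LEAST i. 0 < i \<and> i \<notin># p) \<and>
             size {#x \<in># p. k < x#} > size {#x \<in># p. x < k#}}"

end

theory Submission
  imports Defs "HOL-Computational_Algebra.Formal_Power_Series"
begin

text \<open>Write \<open>P = 1/(q)\<^sub>\<infinity>\<close>. Everything rests on two generating function identities:
  \<open>U\<^sub>m = P C\<^sub>m\<close> for the unimodal compositions and the crank, and the truncated pentagonal number
  theorem \<open>(-1)\<^sup>k\<^sup>-\<^sup>1 M\<^sub>k = P T\<^sub>k - 1\<close> of Andrews and Merca, where \<open>T\<^sub>k\<close> is the truncated pentagonal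
  series. Multiplying the second by \<open>C\<^sub>m\<close> and inserting the first gives the claim.

  For the first identity, splitting compositions at the peak gives
  \<open>U\<^sub>m = \<Sum>\<^sub>N q\<^sup>m\<^sup>N/(q)\<^sub>N\<^sup>2\<close> for \<open>m \<ge> 1\<close>, and splitting partitions by the number \<open>w\<close> of ones and the
  number \<open>s\<close> of parts larger than \<open>w\<close> gives the summand \<open>(1 - q) q\<^sup>w\<^sup>+\<^sup>s\<^sup>+\<^sup>w\<^sup>s/((q)\<^sub>w (q)\<^sub>s)\<close>, which is symmetric
  in \<open>w\<close> and \<open>s\<close>; hence \<open>2 C\<^sub>0 + C\<^sub>2 = P\<close>. On the other side \<open>U\<^sub>0 + U\<^sub>1\<close> telescopes to \<open>P\<^sup>2\<close>, and
  \<open>U\<^sub>2 = P C\<^sub>2\<close> follows from the Durfee square identity. For the second identity, \<open>M\<^sub>k + M\<^sub>k\<^sub>+\<^sub>1\<close> is a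
  sum over the number of parts larger than the missing part that Euler's identity evaluates in
  closed form.\<close>

unbundle fps_syntax

section \<open>Summation of formal power series\<close>

abbreviation q :: "int fps" where "q \<equiv> fps_X"

definition small :: "(nat \<Rightarrow> int fps) \<Rightarrow> bool" where
  "small f \<longleftrightarrow> (\<forall>i n. n < i \<longrightarrow> f i $ n = 0)"

text \<open>An infinite sum of power series; it is the true sum only for \<open>small\<close> families, where the terms
  with \<open>i > n\<close> do not contribute to the coefficient of \<open>q\<^sup>n\<close>.\<close>

definition fsum :: "(nat \<Rightarrow> int fps) \<Rightarrow> int fps" where
  "fsum f = Abs_fps (\<lambda>n. \<Sum>i\<le>n. f i $ n)"

lemma small_power: "(\<And>i. i \<le> a i) \<Longrightarrow> small (\<lambda>i. q ^ a i * f i)"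
  unfolding small_def by (simp add: fps_X_power_mult_nth) (meson le_trans not_less)

lemma fsum_nth: "small f \<Longrightarrow> n \<le> N \<Longrightarrow> fsum f $ n = (\<Sum>i\<le>N. f i $ n)"
  unfolding fsum_def small_def by (auto intro!: sum.mono_neutral_left simp: not_le[symmetric])

lemma small_mult: "small f \<Longrightarrow> small (\<lambda>i. c * f i)"
  unfolding small_def by (auto simp: fps_mult_nth intro!: sum.neutral)

lemma small_if: "small f \<Longrightarrow> small (\<lambda>i. if b i then f i else 0)"
  unfolding small_def by auto

lemma fsum_add: "fsum (\<lambda>i. f i + g i) = fsum f + fsum g"
  by (rule fps_ext) (simp add: fsum_def sum.distrib)

lemma fsum_diff: "fsum (\<lambda>i. f i - g i) = fsum f - fsum g"
  by (rule fps_ext) (simp add: fsum_def sum_subtractf)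

text \<open>In each coefficient both sums run over the same finite range \<open>{..n}\<close>, so
  this is an exchange of finite sums.\<close>

lemma fsum_swap: "fsum (\<lambda>i. fsum (f i)) = fsum (\<lambda>j. fsum (\<lambda>i. f i j))"
  by (rule fps_ext) (simp add: fsum_def, rule sum.swap)

text \<open>Coefficient \<open>n\<close> of the product calls for sums up to \<open>n - k\<close>;
  smallness lets every one of them run up to \<open>n\<close>.\<close>

lemma fsum_mult:
  assumes "small f"
  shows "fsum (\<lambda>i. c * f i) = c * fsum f"
proof (rule fps_ext)
  fix n
  have "fsum (\<lambda>i. c * f i) $ n = (\<Sum>i\<le>n. \<Sum>k=0..n. c $ k * f i $ (n - k))"
    by (simp add: fsum_def fps_mult_nth)
  also have "\<dots> = (\<Sum>k=0..n. c $ k * (\<Sum>i\<le>n. f i $ (n - k)))"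
    by (subst sum.swap) (simp add: sum_distrib_left)
  also have "\<dots> = (\<Sum>k=0..n. c $ k * fsum f $ (n - k))"
    by (intro sum.cong refl) (simp add: fsum_nth[OF assms, symmetric])
  finally show "fsum (\<lambda>i. c * f i) $ n = (c * fsum f) $ n"
    by (simp add: fps_mult_nth)
qed

lemma fsum_shift:
  assumes "small f"
  shows "fsum f = (\<Sum>i<k. f i) + fsum (\<lambda>i. f (k + i))"
proof (rule fps_ext)
  fix n
  have sm: "small (\<lambda>i. f (k + i))"
    using assms unfolding small_def by auto
  have split: "(\<Sum>i<k + m. f i $ n) = (\<Sum>i<k. f i $ n) + (\<Sum>i<m. f (k + i) $ n)" for m
    by (induction m) auto
  have "fsum f $ n = (\<Sum>i<k + Suc n. f i $ n)"
    using fsum_nth[OF assms, of n "k + n"] by (simp add: lessThan_Suc_atMost)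
  also have "\<dots> = (\<Sum>i<k. f i $ n) + (\<Sum>i<Suc n. f (k + i) $ n)"
    by (rule split)
  finally show "fsum f $ n = ((\<Sum>i<k. f i) + fsum (\<lambda>i. f (k + i))) $ n"
    by (simp add: fsum_def fps_sum_nth lessThan_Suc_atMost)
qed

lemma fsum_Suc: "small f \<Longrightarrow> fsum f = f 0 + fsum (\<lambda>i. f (Suc i))"
  using fsum_shift[of f 1] by simp

text \<open>The upper boundary index moves with the coefficient, which stands in for passing to the
  limit.\<close>

lemma fsum_telescope: "fsum (\<lambda>i. f (Suc i) - f i) $ n = f (Suc n) $ n - f 0 $ n"
proof -
  have "(\<Sum>i\<le>m. f (Suc i) $ n - f i $ n) = f (Suc m) $ n - f 0 $ n" for m
    by (induction m) auto
  then show ?thesis by (simp add: fsum_def)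
qed

section \<open>q-series identities\<close>

text \<open>\<open>R N\<close> stands for \<open>1/(q)\<^sub>N\<close>, and \<open>E a\<close> for \<open>1/(q\<^sup>a; q)\<^sub>\<infinity>\<close>; only the recurrence of the former is
  used, so that no infinite product occurs.\<close>

locale euler_factors =
  fixes R :: "nat \<Rightarrow> int fps"
  assumes R_0: "R 0 = 1"
    and R_Suc: "(1 - q ^ Suc N) * R (Suc N) = R N"
begin

definition E :: "nat \<Rightarrow> int fps" where "E a = fsum (\<lambda>s. q ^ (a * s) * R s)"

lemma small_E: "0 < a \<Longrightarrow> small (\<lambda>s. q ^ (a * s) * f s)"
  by (intro small_power) auto

text \<open>In \<open>E a - E (Suc a)\<close> term \<open>s\<close> carries
  \<open>1 - q ^ s\<close>, which lowers \<open>R s\<close> to \<open>R (s - 1)\<close>; shifting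
  the index brings out \<open>q ^ a\<close>.\<close>

lemma E_Suc:
  assumes "0 < a"
  shows "E (Suc a) = (1 - q ^ a) * E a"
proof -
  have "E a - E (Suc a) = fsum (\<lambda>s. q ^ (a * s) * ((1 - q ^ s) * R s))"
    unfolding E_def fsum_diff[symmetric] by (intro arg_cong[where f = fsum] ext) (simp add: power_add algebra_simps)
  also have "\<dots> = fsum (\<lambda>s. q ^ (a * Suc s) * R s)"
    by (subst fsum_Suc) (simp_all only: R_Suc small_E[OF assms], simp)
  also have "\<dots> = q ^ a * E a"
    unfolding E_def
    by (subst fsum_mult[symmetric], rule small_E[OF assms]) (simp add: power_add mult_ac)
  finally show ?thesis by (simp add: algebra_simps)
qed

text \<open>Each step moves the factor \<open>1 - q ^ Suc N\<close> from the tail to the finite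
  product.\<close>

lemma R_mult_E: "R N * E (Suc N) = E 1"
proof (induction N)
  case (Suc N)
  have "R (Suc N) * E (Suc (Suc N)) = ((1 - q ^ Suc N) * R (Suc N)) * E (Suc N)"
    by (simp only: E_Suc[of "Suc N"] mult_ac)
  then show ?case unfolding R_Suc Suc .
qed (simp add: R_0)

text \<open>Shows that \<open>E a\<close> is \<open>1\<close> up to terms of degree at least
  \<open>a\<close>, so that \<open>R N\<close> approximates \<open>E 1\<close>.\<close>

lemma E_eq: "0 < a \<Longrightarrow> E a = 1 + q ^ a * fsum (\<lambda>s. q ^ (a * s) * R (Suc s))"
  unfolding E_def
  by (subst fsum_Suc, simp add: small_E, subst fsum_mult[symmetric], erule small_E)
    (simp add: R_0 power_add mult_ac)

text \<open>The peak is \<open>N + 1\<close> and splits the composition at its first occurrence: in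
  \<open>U0\<close> the left half has parts up to \<open>N\<close>, the right half up to
  \<open>N + 1\<close>. In \<open>U1\<close> and \<open>U2\<close> the factor \<open>q ^ m\<close>
  is removed, because \<open>u_m(n)\<close> counts compositions of \<open>n + m\<close>.\<close>

definition "U0 = fsum (\<lambda>N. q ^ Suc N * (R N * R (Suc N)))"
definition "U1 = fsum (\<lambda>N. q ^ N * (R N)\<^sup>2)"
definition "U2 = fsum (\<lambda>N. q ^ (2 * N) * (R N)\<^sup>2)"

text \<open>The factor \<open>q ^ N - q ^ (2 * N)\<close> contains \<open>1 - q ^ N\<close>, which
  kills the term at 0 and turns one \<open>R N\<close> into \<open>R (N - 1)\<close>.\<close>

lemma U1_eq: "U1 = U0 + U2"
proof -
  have "U1 - U2 = fsum (\<lambda>N. q ^ N * ((1 - q ^ N) * (R N)\<^sup>2))"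
    unfolding U1_def U2_def fsum_diff[symmetric]
    by (intro arg_cong[where f = fsum] ext) (simp add: power_add algebra_simps mult_2 mult_2_right)
  also have "\<dots> = fsum (\<lambda>N. q ^ Suc N * ((1 - q ^ Suc N) * (R (Suc N))\<^sup>2))"
    by (subst fsum_Suc) (simp_all add: small_power)
  also have "\<dots> = U0"
    unfolding U0_def
  proof (intro arg_cong[where f = fsum] ext)
    fix N
    show "q ^ Suc N * ((1 - q ^ Suc N) * (R (Suc N))\<^sup>2) = q ^ Suc N * (R N * R (Suc N))"
      unfolding R_Suc[symmetric, of N] power2_eq_square by (simp only: mult_ac)
  qed
  finally show ?thesis by (simp add: algebra_simps)
qed

text \<open>By \<open>q ^ Suc N * R (Suc N) = R (Suc N) - R N\<close> the combined summand is a
  difference of squares, and the sum telescopes.\<close>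

lemma U0_plus_U1: "U0 + U1 = (E 1)\<^sup>2"
proof -
  have "U1 = 1 + fsum (\<lambda>N. q ^ Suc N * (R (Suc N))\<^sup>2)"
    unfolding U1_def by (subst fsum_Suc) (simp_all add: small_power R_0)
  then have "U0 + U1 = 1 + fsum (\<lambda>N. q ^ Suc N * (R N * R (Suc N)) + q ^ Suc N * (R (Suc N))\<^sup>2)"
    unfolding U0_def fsum_add by simp
  also have "\<dots> = 1 + fsum (\<lambda>N. (R (Suc N))\<^sup>2 - (R N)\<^sup>2)"
  proof (intro arg_cong[where f = "\<lambda>f. 1 + fsum f"] ext)
    fix N
    show "q ^ Suc N * (R N * R (Suc N)) + q ^ Suc N * (R (Suc N))\<^sup>2 = (R (Suc N))\<^sup>2 - (R N)\<^sup>2"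
      unfolding R_Suc[symmetric, of N] by algebra
  qed
  finally have *: "(U0 + U1) $ n = (R (Suc n))\<^sup>2 $ n" for n
    by (simp add: fsum_telescope[of "\<lambda>N. (R N)\<^sup>2"] R_0)
  show ?thesis
  proof (rule fps_ext)
    fix n
    \<comment> \<open>\<open>(E 1)^2\<close> and \<open>(R (Suc n))^2\<close> differ only in degrees
      above \<open>n + 1\<close>, so their coefficients at \<open>n\<close> agree.\<close>
    obtain G where G: "E (Suc (Suc n)) = 1 + q ^ Suc (Suc n) * G"
      using E_eq by blast
    have "(E 1)\<^sup>2 = (R (Suc n) * (1 + q ^ Suc (Suc n) * G))\<^sup>2"
      using R_mult_E[of "Suc n"] G by simp
    also have "\<dots> = (R (Suc n))\<^sup>2 + q ^ Suc (Suc n) * ((R (Suc n))\<^sup>2 * (2 * G + q ^ Suc (Suc n) * G\<^sup>2))"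
      by algebra
    finally show "(U0 + U1) $ n = (E 1)\<^sup>2 $ n"
      unfolding * by (simp add: fps_X_power_mult_nth del: power_Suc)
  qed
qed

text \<open>A finite Durfee identity, stated for rectangles so that \<open>N\<close> can grow while
  \<open>M\<close> stays fixed. After multiplication by \<open>1 - q ^ Suc N\<close>, split as
  \<open>q ^ (Suc N - w) * (1 - q ^ w) + (1 - q ^ (Suc N - w))\<close>, the terms recombine into the
  sum for \<open>N\<close>.\<close>

lemma durfee:
  "N \<le> M \<Longrightarrow> R N * R M = (\<Sum>w\<le>N. q ^ ((N - w) * (M - w)) * (R w * (R (N - w) * R (M - w))))"
proof (induction N)
  case 0
  then show ?case by (simp add: R_0)
next
  case (Suc N)
  define t where "t = (\<lambda>w. q ^ ((Suc N - w) * (M - w)) * (R w * (R (Suc N - w) * R (M - w))))"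
  \<comment> \<open>The term \<open>w = 0\<close> drops out of the first half and
    \<open>w = Suc N\<close> out of the second, so both become sums over
    \<open>w \<le> N\<close>.\<close>
  have 1: "(\<Sum>w\<le>Suc N. q ^ (Suc N - w) * (1 - q ^ w) * t w) = 
      (\<Sum>w\<le>N. q ^ (N - w) * (1 - q ^ Suc w) * t (Suc w))"
    by (subst sum.atMost_Suc_shift) simp
  have 2: "(\<Sum>w\<le>Suc N. (1 - q ^ (Suc N - w)) * t w) = (\<Sum>w\<le>N. (1 - q ^ (Suc N - w)) * t w)"
    by simp
  have "(1 - q ^ Suc N) * (\<Sum>w\<le>Suc N. t w) = 
     (\<Sum>w\<le>Suc N. q ^ (Suc N - w) * (1 - q ^ w) * t w + (1 - q ^ (Suc N - w)) * t w)"
    unfolding sum_distrib_left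
  proof (intro sum.cong refl)
    fix w assume "w \<in> {..Suc N}"
    then have "q ^ Suc N = q ^ (Suc N - w) * q ^ w"
      by (simp add: power_add[symmetric] del: power_Suc)
    then show "(1 - q ^ Suc N) * t w = q ^ (Suc N - w) * (1 - q ^ w) * t w + (1 - q ^ (Suc N - w)) * t w"
      by (simp only: ring_distribs mult_ac) simp
  qed
  also have "\<dots> = (\<Sum>w\<le>N. q ^ (N - w) * (1 - q ^ Suc w) * t (Suc w) + (1 - q ^ (Suc N - w)) * t w)"
    unfolding sum.distrib 1 2 ..
  also have "\<dots> = (\<Sum>w\<le>N. q ^ ((N - w) * (M - w)) * (R w * (R (N - w) * R (M - w))))"
  proof (intro sum.cong refl)
    fix w assume "w \<in> {..N}"
    \<comment> \<open>\<open>Suc N \<le> M\<close> makes \<open>M - w\<close> positive; with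
      \<open>a\<close> and \<open>b\<close> no truncated subtraction is left in the
      exponents.\<close>
    then obtain a b where ab: "N = w + a" "M = Suc (w + b)"
      using Suc.prems by (metis Suc_le_D Suc_le_mono add_Suc atMost_iff le_Suc_ex le_trans)
    show "q ^ (N - w) * (1 - q ^ Suc w) * t (Suc w) + (1 - q ^ (Suc N - w)) * t w =
       q ^ ((N - w) * (M - w)) * (R w * (R (N - w) * R (M - w)))"
    proof -
      have "t (Suc w) = q ^ (a * b) * (R (Suc w) * (R a * R b))"
        by (simp add: t_def ab)
      moreover have "t w = q ^ (a * Suc b) * q ^ Suc b * (R w * (R (Suc a) * R (Suc b)))"
        by (simp add: t_def ab power_add[symmetric] Suc_diff_le del: power_Suc)
      moreover have "q ^ (a * Suc b) = q ^ a * q ^ (a * b)"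
        by (simp add: power_add)
      moreover have "N - w = a" "Suc N - w = Suc a" "M - w = Suc b"
        using ab by auto
      ultimately have "q ^ (N - w) * (1 - q ^ Suc w) * t (Suc w) + (1 - q ^ (Suc N - w)) * t w =
          q ^ a * q ^ (a * b) * ((1 - q ^ Suc w) * R (Suc w)) * R a * R b
          + ((1 - q ^ Suc a) * R (Suc a)) * (q ^ a * q ^ (a * b) * q ^ Suc b * R w * R (Suc b))"
        by (simp only: mult_ac)
      also have "\<dots> = q ^ a * q ^ (a * b) * R w * R a * ((1 - q ^ Suc b) * R (Suc b) + q ^ Suc b * R (Suc b))"
        unfolding R_Suc by (simp only: distrib_left mult_ac)
      also have "(1 - q ^ Suc b) * R (Suc b) + q ^ Suc b * R (Suc b) = R (Suc b)"
        by (simp add: left_diff_distrib)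
      finally show ?thesis
        by (simp add: ab power_add mult_ac)
    qed
  qed
  also have "\<dots> = R N * R M"
    using Suc by simp
  also have "\<dots> = (1 - q ^ Suc N) * (R (Suc N) * R M)"
    unfolding R_Suc[of N, symmetric] by (simp only: mult_ac)
  finally have "(1 - q ^ Suc N) * (R (Suc N) * R M) = (1 - q ^ Suc N) * (\<Sum>w\<le>Suc N. t w)" ..
  moreover have "1 - q ^ Suc N \<noteq> 0"
    by (metis (no_types) fps_X_power_nth fps_one_nth nat.distinct(1) one_neq_zero right_minus_eq)
  ultimately show ?case
    unfolding t_def using mult_left_cancel by blast
qed

lemma durfee_square: "(R N)\<^sup>2 = (\<Sum>w\<le>N. q ^ (w * w) * ((R w)\<^sup>2 * R (N - w)))"
proof -
  have "(R N)\<^sup>2 = (\<Sum>w\<le>N. q ^ ((N - w) * (N - w)) * (R w * (R (N - w) * R (N - w))))"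
    using durfee[of N N] by (simp add: power2_eq_square)
  also have "\<dots> = (\<Sum>w\<le>N. q ^ (w * w) * ((R w)\<^sup>2 * R (N - w)))"
    by (rule sum.reindex_bij_witness[of _ "\<lambda>w. N - w" "\<lambda>w. N - w"]) (auto simp: power2_eq_square mult_ac)
  finally show ?thesis .
qed

text \<open>Expand each square by \<open>durfee_square\<close> and exchange the sums; for fixed
  \<open>w\<close> the sum over \<open>N = w + s\<close> yields \<open>E 2\<close>.\<close>

lemma U2_eq: "U2 = E 2 * fsum (\<lambda>w. q ^ (w * w + 2 * w) * (R w)\<^sup>2)"
proof -
  \<comment> \<open>Padding by zeros turns the finite Durfee sum into an infinite one, so that the
    sums can be exchanged.\<close>
  define g where "g = (\<lambda>N w. if w \<le> N then q ^ (2 * N) * (q ^ (w * w) * ((R w)\<^sup>2 * R (N - w))) else 0)"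
  have "U2 = fsum (\<lambda>N. fsum (g N))"
    unfolding U2_def
  proof (intro arg_cong[where f = fsum] ext fps_ext)
    fix N n
    have sm: "small (g N)"
      unfolding g_def by (intro small_if small_mult small_power) simp
    \<comment> \<open>The bound \<open>max n N\<close> covers both the cut-off \<open>n\<close> of
      \<open>fsum\<close> and the support \<open>w \<le> N\<close>.\<close>
    have "fsum (g N) $ n = (\<Sum>w\<le>max n N. g N w $ n)"
      by (rule fsum_nth[OF sm]) simp
    also have "\<dots> = (\<Sum>w\<le>N. g N w $ n)"
      by (rule sum.mono_neutral_right) (auto simp: g_def)
    also have "\<dots> = (q ^ (2 * N) * (R N)\<^sup>2) $ n"
      by (subst durfee_square[of N]) (simp add: g_def sum_distrib_left fps_sum_nth)
    finally show "(q ^ (2 * N) * (R N)\<^sup>2) $ n = fsum (g N) $ n" ..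
  qed
  also have "\<dots> = fsum (\<lambda>w. fsum (\<lambda>N. g N w))"
    by (rule fsum_swap)
  also have "\<dots> = fsum (\<lambda>w. E 2 * (q ^ (w * w + 2 * w) * (R w)\<^sup>2))"
  proof (intro arg_cong[where f = fsum] ext)
    fix w
    have "fsum (\<lambda>N. g N w) = (\<Sum>i<w. g i w) + fsum (\<lambda>s. g (w + s) w)"
      unfolding g_def by (intro fsum_shift small_if small_power) simp
    also have "(\<Sum>i<w. g i w) = 0"
      by (simp add: g_def)
    also have "(\<lambda>s. g (w + s) w) = (\<lambda>s. (q ^ (w * w + 2 * w) * (R w)\<^sup>2) * (q ^ (2 * s) * R s))"
      by (simp add: g_def power_add mult_ac fun_eq_iff distrib_left)
    also have "fsum \<dots> = (q ^ (w * w + 2 * w) * (R w)\<^sup>2) * E 2"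
      unfolding E_def by (intro fsum_mult small_E) simp
    finally show "fsum (\<lambda>N. g N w) = E 2 * (q ^ (w * w + 2 * w) * (R w)\<^sup>2)"
      by (simp add: mult_ac)
  qed
  also have "\<dots> = E 2 * fsum (\<lambda>w. q ^ (w * w + 2 * w) * (R w)\<^sup>2)"
    by (intro fsum_mult small_power) simp
  finally show ?thesis .
qed

section \<open>Series indexed by the number of ones and of large parts\<close>

definition "T w s = q ^ (w + s + w * s) * (R w * R s)"

text \<open>The crank has the sign of \<open>s - w\<close>. At \<open>w = 0\<close> the summand does
  not count the partitions with these \<open>w\<close> and \<open>s\<close>; the symmetric formula
  is kept there, and the discrepancy is what the conventions at \<open>n = 1\<close> record.\<close>

definition "C0 = (1 - q) * fsum (\<lambda>w. fsum (\<lambda>s. if w < s then T w s else 0))"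
definition "C2 = (1 - q) * fsum (\<lambda>w. T w w)"

lemma T_commute: "T w s = T s w"
  by (simp add: T_def mult_ac add_ac)

text \<open>Since \<open>s + w * s = Suc w * s\<close>, the sum over \<open>s\<close> is
  \<open>E (Suc w)\<close>, and \<open>R w\<close> completes it to \<open>E 1\<close>.\<close>

lemma fsum_T: "fsum (T w) = q ^ w * E 1"
proof -
  have "fsum (T w) = fsum (\<lambda>s. (q ^ w * R w) * (q ^ (Suc w * s) * R s))"
    by (intro arg_cong[where f = fsum] ext) (simp add: T_def power_add mult_ac)
  also have "\<dots> = (q ^ w * R w) * E (Suc w)"
    unfolding E_def by (intro fsum_mult small_E) simp
  finally show ?thesis using R_mult_E[of w] by (simp add: mult.assoc)
qed

text \<open>By symmetry of \<open>T\<close> the left side is a sum over all \<open>w\<close> and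
  \<open>s\<close>; what remains is the geometric series, which cancels
  \<open>1 - q\<close>.\<close>

lemma C_total: "2 * C0 + C2 = E 1"
proof -
  \<comment> \<open>Writes the diagonal as a double sum; the cut-off at \<open>n\<close> is harmless
    because \<open>T w w\<close> has no term below degree \<open>w\<close>.\<close>
  have *: "fsum (\<lambda>s. if s = w then T w w else 0) = T w w" for w
  proof (rule fps_ext)
    fix n
    have "fsum (\<lambda>s. if s = w then T w w else 0) $ n = (if w \<le> n then T w w $ n else 0)"
      unfolding fsum_def by (simp add: if_distrib[of "\<lambda>f. f $ n"] cong: if_cong)
    also have "\<dots> = T w w $ n"
      by (simp add: T_def fps_X_power_mult_nth)
    finally show "fsum (\<lambda>s. if s = w then T w w else 0) $ n = T w w $ n" .
  qed
  have diag: "fsum (\<lambda>w. T w w) = fsum (\<lambda>w. fsum (\<lambda>s. if s = w then T w w else 0))"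
    by (simp only: *)
  have "fsum (\<lambda>w. fsum (\<lambda>s. if w < s then T w s else 0)) = fsum (\<lambda>s. fsum (\<lambda>w. if w < s then T s w else 0))"
    by (subst fsum_swap) (simp only: T_commute)
  then have "2 * C0 + C2 = (1 - q) * (fsum (\<lambda>w. fsum (\<lambda>s. if w < s then T w s else 0))
      + fsum (\<lambda>s. fsum (\<lambda>w. if w < s then T s w else 0)) + fsum (\<lambda>w. T w w))"
    by (simp add: C0_def C2_def algebra_simps)
  also have "\<dots> = (1 - q) * fsum (\<lambda>w. fsum (T w))"
    by (subst diag, unfold fsum_add[symmetric], intro arg_cong[where f = "\<lambda>f. (1 - q) * f"] arg_cong[where f = fsum] ext)
      (auto simp: linorder_neq_iff)
  also have "fsum (\<lambda>w. fsum (T w)) = E 1 * fsum (\<lambda>w. q ^ w)"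
    unfolding fsum_T using fsum_mult[of "\<lambda>w. q ^ w * 1" "E 1"] small_power[of "\<lambda>w. w" "\<lambda>_. 1"]
    by (simp add: mult_ac)
  also have "fsum (\<lambda>w. q ^ w) = 1 + q * fsum (\<lambda>w. q ^ w)"
    using fsum_Suc[of "\<lambda>w. q ^ w * 1"] fsum_mult[of "\<lambda>w. q ^ w * 1" q] small_power[of "\<lambda>w. w" "\<lambda>_. 1"]
    by simp
  then have "(1 - q) * (E 1 * fsum (\<lambda>w. q ^ w)) = E 1"
    by algebra
  finally show ?thesis .
qed

lemma U2_C2: "U2 = E 1 * C2"
proof -
  have "U2 = ((1 - q) * E 1) * fsum (\<lambda>w. T w w)"
    using U2_eq E_Suc[of 1] by (simp add: T_def power2_eq_square numeral_2_eq_2 add_ac)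
  then show ?thesis by (simp add: C2_def mult_ac)
qed

text \<open>Eliminating \<open>U1\<close> and \<open>U2\<close> leaves
  \<open>2 * U0 = E 1 * (E 1 - C2)\<close>, and \<open>E 1 - C2 = 2 * C0\<close>.\<close>

lemma U0_C0: "U0 = E 1 * C0"
proof -
  have "2 * U0 = 2 * (E 1 * C0)"
    using U0_plus_U1 U1_eq U2_C2 C_total by algebra
  then show ?thesis by simp
qed

end

section \<open>Generating functions of multisets\<close>

definition gf :: "('a \<Rightarrow> nat) \<Rightarrow> 'a set \<Rightarrow> int fps" where
  "gf w A = Abs_fps (\<lambda>n. int (card {a \<in> A. w a = n}))"

text \<open>\<open>card\<close> returns \<open>0\<close> on infinite sets; finite weight classes
  keep \<open>gf\<close> meaningful.\<close>

definition graded :: "('a \<Rightarrow> nat) \<Rightarrow> 'a set \<Rightarrow> bool" where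
  "graded w A \<longleftrightarrow> (\<forall>n. finite {a \<in> A. w a = n})"

lemma graded_subset: "graded w B \<Longrightarrow> A \<subseteq> B \<Longrightarrow> graded w A"
  unfolding graded_def by (auto intro: finite_subset[rotated])

lemma gf_empty [simp]: "gf w {} = 0"
  by (rule fps_ext) (simp add: gf_def)

lemma gf_singleton: "gf w {a} = q ^ w a"
proof (rule fps_ext)
  fix n
  have "{x. x = a \<and> w x = n} = (if w a = n then {a} else {})" by auto
  then show "gf w {a} $ n = (q ^ w a) $ n"
    by (simp add: gf_def fps_X_power_nth)
qed

lemma gf_image:
  assumes "inj_on f A" "\<And>a. a \<in> A \<Longrightarrow> w (f a) = c + v a"
  shows "gf w (f ` A) = q ^ c * gf v A"
proof (rule fps_ext)
  fix n
  have "{b \<in> f ` A. w b = n} = (if n < c then {} else f ` {a \<in> A. v a = n - c})"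
    using assms(2) by auto
  moreover have "card (f ` {a \<in> A. v a = n - c}) = card {a \<in> A. v a = n - c}"
    by (rule card_image) (rule inj_on_subset[OF assms(1)], auto)
  ultimately show "gf w (f ` A) $ n = (q ^ c * gf v A) $ n"
    by (simp add: gf_def fps_X_power_mult_nth)
qed

lemma gf_Un:
  assumes "graded w A" "graded w B" "A \<inter> B = {}"
  shows "gf w (A \<union> B) = gf w A + gf w B"
proof (rule fps_ext)
  fix n
  have "{a \<in> A \<union> B. w a = n} = {a \<in> A. w a = n} \<union> {a \<in> B. w a = n}"
    by auto
  then show "gf w (A \<union> B) $ n = (gf w A + gf w B) $ n"
    using assms by (auto simp: gf_def graded_def intro!: card_Un_disjoint simp flip: of_nat_add)
qed

lemma gf_times:
  assumes "graded u A" "graded v B"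
  shows "gf (\<lambda>(a, b). u a + v b) (A \<times> B) = gf u A * gf v B"
proof (rule fps_ext)
  fix n
  have "{x \<in> A \<times> B. (case x of (a, b) \<Rightarrow> u a + v b) = n} =
      (\<Union>i\<in>{0..n}. {a \<in> A. u a = i} \<times> {b \<in> B. v b = n - i})"
    by auto
  also have "card \<dots> = (\<Sum>i=0..n. card {a \<in> A. u a = i} * card {b \<in> B. v b = n - i})"
    using assms unfolding graded_def
    by (subst card_UN_disjoint) (auto simp: card_cartesian_product)
  finally show "gf (\<lambda>(a, b). u a + v b) (A \<times> B) $ n = (gf u A * gf v B) $ n"
    by (simp add: gf_def fps_mult_nth)
qed

text \<open>The bound \<open>f a \<le> w a\<close> confines an element of weight \<open>n\<close> to
  the fibres \<open>i \<le> n\<close>, exactly the range of \<open>fsum\<close>.\<close>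

lemma gf_fiber:
  assumes "graded w A" "\<And>a. a \<in> A \<Longrightarrow> f a \<le> w a"
  shows "gf w A = fsum (\<lambda>i. gf w {a \<in> A. f a = i})"
proof (rule fps_ext)
  fix n
  have "{a \<in> A. w a = n} = (\<Union>i\<in>{..n}. {a \<in> {a \<in> A. f a = i}. w a = n})"
    using assms(2) by auto
  also have "card \<dots> = (\<Sum>i\<le>n. card {a \<in> {a \<in> A. f a = i}. w a = n})"
  proof (rule card_UN_disjoint)
    have "finite {a \<in> A. w a = n}" using assms(1) by (simp add: graded_def)
    then show "\<forall>i\<in>{..n}. finite {a \<in> {a \<in> A. f a = i}. w a = n}"
      by (auto elim: finite_subset[rotated])
  qed auto
  finally show "gf w A $ n = fsum (\<lambda>i. gf w {a \<in> A. f a = i}) $ n"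
    by (simp add: gf_def fsum_def)
qed

section \<open>Partitions with parts in a prescribed set\<close>

definition parts_in :: "nat set \<Rightarrow> nat multiset set" where
  "parts_in S = {p. set_mset p \<subseteq> S}"

lemma partitions_eq: "partitions n = {p \<in> parts_in {0<..}. sum_mset p = n}"
  unfolding partitions_def parts_in_def by auto

lemma size_le_sum_mset: "p \<in> parts_in {0<..} \<Longrightarrow> size p \<le> sum_mset p"
  unfolding parts_in_def by (induction p) auto

lemma member_le_sum_mset: "x \<in># p \<Longrightarrow> x \<le> sum_mset p" for x :: nat
  by (auto dest!: multi_member_split)

lemma graded_parts: "graded sum_mset (parts_in {0<..})"
  unfolding graded_def
proof
  fix n
  have "{p \<in> parts_in {0<..}. sum_mset p = n} \<subseteq> (\<Union>k\<le>n. multisets_of_size {..n} k)"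
    using size_le_sum_mset member_le_sum_mset by (fastforce simp: multisets_of_size_def)
  then show "finite {p \<in> parts_in {0<..}. sum_mset p = n}"
    by (rule finite_subset) auto
qed

lemma graded_parts_subset: "A \<subseteq> parts_in S \<Longrightarrow> S \<subseteq> {0<..} \<Longrightarrow> graded sum_mset A"
  by (rule graded_subset[OF graded_parts]) (auto simp: parts_in_def)

lemma one_minus_mult_eq: "x = h + p * x \<Longrightarrow> (1 - p) * x = h" for x :: "'a::ring_1"
  by (metis add_diff_cancel_right' left_diff_distrib mult_1)

text \<open>Either \<open>a\<close> does not occur, or removing one copy leaves a multiset of the
  same kind; this gives \<open>x = h + q ^ a * x\<close>.\<close>

lemma gf_parts_insert:
  assumes "a \<notin> S" "0 < a" "S \<subseteq> {0<..}"
  shows "(1 - q ^ a) * gf sum_mset (parts_in (insert a S)) = gf sum_mset (parts_in S)"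
proof -
  have "p \<in> parts_in S \<union> add_mset a ` parts_in (insert a S)" if "p \<in> parts_in (insert a S)" for p
  proof (cases "a \<in># p")
    case True
    then obtain p' where "p = add_mset a p'" by (auto dest: multi_member_split)
    with that show ?thesis by (auto simp: parts_in_def)
  qed (use that in \<open>auto simp: parts_in_def\<close>)
  then have eq: "parts_in (insert a S) = parts_in S \<union> add_mset a ` parts_in (insert a S)"
    by (auto simp: parts_in_def)
  have "gf sum_mset (parts_in S \<union> add_mset a ` parts_in (insert a S)) =
      gf sum_mset (parts_in S) + gf sum_mset (add_mset a ` parts_in (insert a S))"
  proof (intro gf_Un graded_parts_subset[of _ "insert a S"])
    show "parts_in S \<inter> add_mset a ` parts_in (insert a S) = {}"
      using assms(1) by (auto simp: parts_in_def)
  qed (use assms in \<open>auto simp: parts_in_def\<close>)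
  also have "gf sum_mset (add_mset a ` parts_in (insert a S)) = q ^ a * gf sum_mset (parts_in (insert a S))"
    by (rule gf_image) (auto simp: inj_on_def)
  finally show ?thesis unfolding eq[symmetric] by (rule one_minus_mult_eq)
qed

definition R :: "nat \<Rightarrow> int fps" where "R N = gf sum_mset (parts_in {1..N})"

text \<open>Makes every identity of the locale available for partitions into parts of size at most
  \<open>N\<close>.\<close>

interpretation euler_factors R
proof
  show "R 0 = 1"
    by (simp add: R_def parts_in_def gf_singleton)
  show "(1 - q ^ Suc N) * R (Suc N) = R N" for N
    using gf_parts_insert[of "Suc N" "{1..N}"] by (simp add: R_def atLeastAtMostSuc_conv subset_iff)
qed

text \<open>The source of the factor \<open>1 - q\<close> in the crank series. At
  \<open>w = 0\<close> the part 1 is absent from the start, so that case is treated apart.\<close>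

lemma gf_parts_from_2: "1 \<le> w \<Longrightarrow> gf sum_mset (parts_in {2..w}) = (1 - q) * R w"
proof -
  assume "1 \<le> w"
  then have "{1..w} = insert 1 {2..w}" by auto
  then show ?thesis
    using gf_parts_insert[of 1 "{2..w}"] by (simp add: R_def subset_iff)
qed

lemma one_minus_power_nonzero: "0 < n \<Longrightarrow> 1 - q ^ n \<noteq> 0"
proof
  assume "0 < n" "1 - q ^ n = 0"
  then have "(1 - q ^ n) $ 0 = 0" by simp
  with \<open>0 < n\<close> show False by (simp add: fps_X_power_nth)
qed

section \<open>Partitions with a prescribed number of parts\<close>

definition sized :: "nat \<Rightarrow> nat \<Rightarrow> nat multiset set" where
  "sized a s = {p \<in> parts_in {a..}. size p = s}"

lemma gf_sized_Suc: "gf sum_mset (sized (Suc a) s) = q ^ s * gf sum_mset (sized a s)"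
proof -
  have "sized (Suc a) s = image_mset Suc ` sized a s"
  proof (intro equalityI subsetI)
    fix p assume p: "p \<in> sized (Suc a) s"
    have "image_mset Suc (image_mset (\<lambda>x. x - 1) p) = image_mset id p"
      unfolding multiset.map_comp o_def
      by (rule image_mset_cong) (use p in \<open>auto simp: sized_def parts_in_def\<close>)
    moreover have "image_mset (\<lambda>x. x - 1) p \<in> sized a s"
      using p by (auto simp: sized_def parts_in_def)
    ultimately show "p \<in> image_mset Suc ` sized a s"
      by (metis image_eqI id_apply image_mset.id)
  qed (auto simp: sized_def parts_in_def)
  moreover have "sum_mset (image_mset Suc p) = size p + sum_mset p" for p
    by (induction p) auto
  ultimately show ?thesis
    by (simp only:, intro gf_image inj_on_subset[OF multiset.inj_map[OF inj_Suc]])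
      (auto simp: sized_def)
qed

text \<open>Either one part \<open>a\<close> is removed, or all \<open>Suc s\<close> parts exceed
  \<open>a\<close> and can be lowered by 1; the second case reproduces the series with a factor
  \<open>q ^ Suc s\<close>.\<close>

lemma gf_sized: "0 < a \<Longrightarrow> gf sum_mset (sized a s) = q ^ (a * s) * R s"
proof (induction s)
  case 0
  have "sized a 0 = {{#}}" by (auto simp: sized_def parts_in_def)
  then show ?case by (simp add: R_0 gf_singleton)
next
  case (Suc s)
  have "p \<in> add_mset a ` sized a s \<union> sized (Suc a) (Suc s)" if "p \<in> sized a (Suc s)" for p
  proof (cases "a \<in># p")
    case True
    then obtain p' where "p = add_mset a p'" by (auto dest: multi_member_split)
    with that show ?thesis by (auto simp: sized_def parts_in_def)
  next
    case False
    have "Suc a \<le> x" if "x \<in># p" for x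
      using that False \<open>p \<in> sized a (Suc s)\<close> by (cases "x = a") (auto simp: sized_def parts_in_def Suc_le_eq)
    with that show ?thesis by (auto simp: sized_def parts_in_def)
  qed
  moreover have "add_mset a ` sized a s \<union> sized (Suc a) (Suc s) \<subseteq> sized a (Suc s)"
    by (auto simp: sized_def parts_in_def Suc_le_eq subset_iff intro: less_imp_le)
  ultimately have eq: "sized a (Suc s) = add_mset a ` sized a s \<union> sized (Suc a) (Suc s)"
    by blast
  have "gf sum_mset (sized a (Suc s)) = gf sum_mset (add_mset a ` sized a s) + gf sum_mset (sized (Suc a) (Suc s))"
    unfolding eq
  proof (intro gf_Un graded_parts_subset[of _ "{a..}"])
    show "add_mset a ` sized a s \<inter> sized (Suc a) (Suc s) = {}"
      by (auto simp: parts_in_def sized_def)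
  qed (use Suc.prems in \<open>auto simp: parts_in_def sized_def\<close>)
  also have "gf sum_mset (add_mset a ` sized a s) = q ^ a * gf sum_mset (sized a s)"
    by (rule gf_image) (auto simp: inj_on_def)
  finally have "(1 - q ^ Suc s) * gf sum_mset (sized a (Suc s)) = q ^ a * gf sum_mset (sized a s)"
    unfolding gf_sized_Suc by (rule one_minus_mult_eq)
  also have "\<dots> = q ^ a * (q ^ (a * s) * R s)"
    using Suc by simp
  also have "\<dots> = (1 - q ^ Suc s) * (q ^ (a * Suc s) * R (Suc s))"
    unfolding R_Suc[of s, symmetric] by (simp add: power_add mult_ac)
  finally show ?case
    using one_minus_power_nonzero[of "Suc s"] mult_left_cancel by blast
qed

text \<open>As \<open>S\<close> and \<open>S'\<close> are disjoint, the two summands are recovered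
  by filtering.\<close>

lemma gf_plus:
  assumes "A \<subseteq> parts_in S" "B \<subseteq> parts_in S'" "S \<inter> S' = {}" "S \<subseteq> {0<..}" "S' \<subseteq> {0<..}"
  shows "gf sum_mset ((\<lambda>(a, b). a + b) ` (A \<times> B)) = gf sum_mset A * gf sum_mset B"
proof -
  have filt: "filter_mset (\<lambda>x. x \<in> S) (a + b) = a" "filter_mset (\<lambda>x. x \<in> S') (a + b) = b"
    if "a \<in> A" "b \<in> B" for a b
  proof -
    have "set_mset a \<subseteq> S" "set_mset b \<subseteq> S'"
      using that assms by (auto simp: parts_in_def)
    with \<open>S \<inter> S' = {}\<close> show "filter_mset (\<lambda>x. x \<in> S) (a + b) = a" "filter_mset (\<lambda>x. x \<in> S') (a + b) = b"
      by (auto simp: multiset_eq_iff count_eq_zero_iff)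
  qed
  have "inj_on (\<lambda>(a, b). a + b) (A \<times> B)"
    by (rule inj_on_inverseI[of _ "\<lambda>p. (filter_mset (\<lambda>x. x \<in> S) p, filter_mset (\<lambda>x. x \<in> S') p)"])
      (use filt in auto)
  then have "gf sum_mset ((\<lambda>(a, b). a + b) ` (A \<times> B)) = q ^ 0 * gf (\<lambda>(a, b). sum_mset a + sum_mset b) (A \<times> B)"
    by (rule gf_image) auto
  also have "\<dots> = gf sum_mset A * gf sum_mset B"
    by (simp add: gf_times graded_parts_subset[OF assms(1,4)] graded_parts_subset[OF assms(2,5)])
  finally show ?thesis .
qed

section \<open>The truncated pentagonal number theorem\<close>

definition Q :: "nat \<Rightarrow> int fps" where "Q n = (\<Prod>i=1..n. 1 - q ^ i)"

lemma Q_Suc: "Q (Suc n) = (1 - q ^ Suc n) * Q n"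
  by (simp add: Q_def mult.commute)

lemma Q_mult_R: "Q n * R n = 1"
proof (induction n)
  case (Suc n)
  have "Q (Suc n) * R (Suc n) = Q n * ((1 - q ^ Suc n) * R (Suc n))"
    by (simp only: Q_Suc mult_ac)
  then show ?case unfolding R_Suc Suc .
qed (simp add: Q_def R_0)

text \<open>The parts smaller than the least missing part \<open>K + 1\<close> when there are \<open>s\<close> parts larger than it.\<close>

definition initial :: "nat \<Rightarrow> nat \<Rightarrow> nat multiset set" where
  "initial K s = {p. set_mset p = {1..K} \<and> size p < s}"

lemma initial_subset: "initial K s \<subseteq> parts_in {1..K}"
  by (auto simp: initial_def parts_in_def)

lemma graded_initial: "graded sum_mset (initial K s)"
  by (rule graded_parts_subset[OF initial_subset]) auto

text \<open>After one copy of the largest part is removed, that part either still occurs or is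
  gone.\<close>

lemma initial_Suc: "initial (Suc K) (Suc s) = add_mset (Suc K) ` (initial (Suc K) s \<union> initial K s)"
proof (intro equalityI subsetI)
  fix p assume p: "p \<in> initial (Suc K) (Suc s)"
  then have "Suc K \<in># p" by (auto simp: initial_def)
  then obtain p' where p': "p = add_mset (Suc K) p'" by (auto dest: multi_member_split)
  have "set_mset p' = {1..Suc K} \<or> set_mset p' = {1..K}"
  proof (cases "Suc K \<in># p'")
    case True
    with p' have "set_mset p' = set_mset p" by auto
    with p have "set_mset p' = {1..Suc K}" by (simp add: initial_def)
    then show ?thesis ..
  next
    case False
    have "set_mset p' = set_mset p - {Suc K}" using False p' by auto
    also have "set_mset p = {1..Suc K}" using p by (simp add: initial_def)
    also have "{1..Suc K} - {Suc K} = {1..K}" by auto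
    finally show ?thesis ..
  qed
  with p p' show "p \<in> add_mset (Suc K) ` (initial (Suc K) s \<union> initial K s)"
    by (auto simp: initial_def)
next
  fix p assume "p \<in> add_mset (Suc K) ` (initial (Suc K) s \<union> initial K s)"
  moreover have "insert (Suc K) {1..Suc K} = {1..Suc K}" "insert (Suc K) {1..K} = {1..Suc K}"
    by auto
  ultimately show "p \<in> initial (Suc K) (Suc s)"
    by (elim imageE) (simp only: initial_def Un_iff mem_Collect_eq set_mset_add_mset_insert size_add_mset Suc_less_eq, metis)
qed

lemma gf_initial_Suc:
  "gf sum_mset (initial (Suc K) (Suc s)) =
     q ^ Suc K * (gf sum_mset (initial (Suc K) s) + gf sum_mset (initial K s))"
proof -
  have "initial (Suc K) s \<inter> initial K s = {}"
    by (auto simp: initial_def)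
  then have "gf sum_mset (initial (Suc K) s \<union> initial K s) =
      gf sum_mset (initial (Suc K) s) + gf sum_mset (initial K s)"
    by (intro gf_Un graded_initial)
  then show ?thesis
    unfolding initial_Suc by (subst gf_image[where c = "Suc K" and v = sum_mset]) (auto simp: inj_on_def)
qed

text \<open>\<open>Q (s - 1) * R K * R (s - 1 - K)\<close> is the Gaussian binomial coefficient
  \<open>s - 1\<close> over \<open>K\<close>, and \<open>gf_initial_Suc\<close> is its q-Pascal
  rule.\<close>

lemma gf_initial:
  "gf sum_mset (initial K s) = (if K < s then q ^ (\<Sum>{..K}) * (Q (s - 1) * R K * R (s - 1 - K)) else 0)"
proof (induction s arbitrary: K)
  case 0
  then show ?case by (simp add: initial_def)
next
  case (Suc s)
  show ?case
  proof (cases K)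
    case 0
    have "initial 0 (Suc s) = {{#}}" by (auto simp: initial_def)
    with 0 Q_mult_R[of s] show ?thesis by (simp add: gf_singleton R_0)
  next
    case K: (Suc L)
    \<comment> \<open>Case 1: there is no room for all parts up to \<open>K\<close>; case 2: each
      occurs exactly once; case 3: up to \<open>d + 1\<close> further copies fit.\<close>
    consider "s \<le> L" | "s = Suc L" | d where "s = Suc (Suc (L + d))"
      using less_natE not_le_imp_less by (metis Suc_lessI add_Suc)
    then show ?thesis
    proof cases
      case 1
      then show ?thesis unfolding K gf_initial_Suc Suc by simp
    next
      case 2
      then show ?thesis
        unfolding K gf_initial_Suc Suc using Q_mult_R[of L] Q_mult_R[of "Suc L"]
        by (simp add: R_0 power_add mult_ac)
    next
      case 3
      \<comment> \<open>Rewriting \<open>R d\<close> and \<open>R L\<close> by their recurrences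
        gives both terms the common factor \<open>R (Suc L) * R (Suc d)\<close>.\<close>
      have "q ^ Suc L * (q ^ (\<Sum>{..L}) * q ^ Suc L * (Q (Suc (L + d)) * R (Suc L) * R d)
              + q ^ (\<Sum>{..L}) * (Q (Suc (L + d)) * R L * R (Suc d)))
          = q ^ Suc L * q ^ (\<Sum>{..L}) * (Q (Suc (L + d)) * R (Suc L) * R (Suc d)) *
             (q ^ Suc L * (1 - q ^ Suc d) + (1 - q ^ Suc L))"
        unfolding R_Suc[of d, symmetric] R_Suc[of L, symmetric]
        by (simp only: distrib_left mult_ac)
      also have "q ^ Suc L * (1 - q ^ Suc d) + (1 - q ^ Suc L) = 1 - q ^ Suc (Suc (L + d))"
        by (simp add: algebra_simps power_add)
      finally have "q ^ Suc L * (q ^ (\<Sum>{..L}) * q ^ Suc L * (Q (Suc (L + d)) * R (Suc L) * R d)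
              + q ^ (\<Sum>{..L}) * (Q (Suc (L + d)) * R L * R (Suc d)))
          = q ^ Suc L * q ^ (\<Sum>{..L}) * (Q (Suc (L + d)) * R (Suc L) * R (Suc d)) *
             (1 - q ^ Suc (Suc (L + d)))" .
      moreover have "q ^ (\<Sum>{..Suc L}) = q ^ (\<Sum>{..L}) * q ^ Suc L"
        by (simp add: power_add mult_ac)
      ultimately show ?thesis
        unfolding K gf_initial_Suc Suc using 3
        by (simp add: Q_Suc[of "Suc (L + d)"] mult_ac del: power_Suc sum.atMost_Suc)
    qed
  qed
qed

section \<open>Partitions by their least missing part\<close>

definition mex :: "nat multiset \<Rightarrow> nat" where "mex p = (LEAST i. 0 < i \<and> i \<notin># p)"

lemma mex_eq_iff: "mex p = Suc K \<longleftrightarrow> {1..K} \<subseteq> set_mset p \<and> Suc K \<notin># p"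
proof
  have "\<exists>i. 0 < i \<and> i \<notin># p"
    using ex_new_if_finite[OF infinite_UNIV_nat, of "insert 0 (set_mset p)"] by auto
  then have *: "0 < mex p \<and> mex p \<notin># p"
    unfolding mex_def by (rule LeastI_ex)
  assume mex: "mex p = Suc K"
  have "i \<in># p" if "0 < i" "i < Suc K" for i
    using not_less_Least[of i "\<lambda>i. 0 < i \<and> i \<notin># p"] that mex by (simp add: mex_def)
  with * mex show "{1..K} \<subseteq> set_mset p \<and> Suc K \<notin># p" by auto
next
  assume p: "{1..K} \<subseteq> set_mset p \<and> Suc K \<notin># p"
  show "mex p = Suc K"
    unfolding mex_def
  proof (rule Least_equality)
    fix i assume "0 < i \<and> i \<notin># p"
    then have "i \<notin> {1..K}" "0 < i" using p by blast+
    then show "Suc K \<le> i" by simp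
  qed (use p in simp)
qed

definition mex_parts :: "nat \<Rightarrow> nat multiset set" where
  "mex_parts k = {p \<in> parts_in {0<..}. k = mex p \<and> size {#x \<in># p. x < k#} < size {#x \<in># p. k < x#}}"

text \<open>As \<open>Suc K\<close> is missing, \<open>p\<close> falls apart into smaller and larger
  parts; once the number \<open>s\<close> of larger parts is fixed, the comparison of the two counts
  becomes the size bound in \<open>initial\<close>.\<close>

lemma mex_parts_eq:
  "{p \<in> mex_parts (Suc K). size {#x \<in># p. Suc K < x#} = s} =
     (\<lambda>(a, b). a + b) ` (initial K s \<times> sized (Suc (Suc K)) s)"
proof (intro equalityI subsetI)
  fix p assume p: "p \<in> {p \<in> mex_parts (Suc K). size {#x \<in># p. Suc K < x#} = s}"
  then have mex: "{1..K} \<subseteq> set_mset p \<and> Suc K \<notin># p"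
    unfolding mex_eq_iff[symmetric] by (simp add: mex_parts_def)
  have "p = {#x \<in># p. x < Suc K#} + {#x \<in># p. Suc K < x#}"
    using mex by (auto simp: multiset_eq_iff count_eq_zero_iff)
  moreover have "{#x \<in># p. x < Suc K#} \<in> initial K s"
    using mex p by (auto simp: initial_def mex_parts_def parts_in_def Suc_le_eq)
  moreover have "{#x \<in># p. Suc K < x#} \<in> sized (Suc (Suc K)) s"
    using p by (auto simp: sized_def parts_in_def Suc_le_eq)
  ultimately show "p \<in> (\<lambda>(a, b). a + b) ` (initial K s \<times> sized (Suc (Suc K)) s)"
    by force
next
  fix p assume "p \<in> (\<lambda>(a, b). a + b) ` (initial K s \<times> sized (Suc (Suc K)) s)"
  then obtain a b where p: "p = a + b" and a: "a \<in> initial K s" and b: "b \<in> sized (Suc (Suc K)) s"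
    by auto
  have sa: "set_mset a = {1..K}" and sb: "set_mset b \<subseteq> {Suc (Suc K)..}"
    using a b by (auto simp: initial_def sized_def parts_in_def)
  then have "{#x \<in># p. x < Suc K#} = a + {#}" "{#x \<in># p. Suc K < x#} = {#} + b"
    unfolding p by (intro multiset_eqI; force simp: count_eq_zero_iff)+
  moreover have "mex p = Suc K"
    unfolding mex_eq_iff using sa sb by (auto simp: p)
  ultimately show "p \<in> {p \<in> mex_parts (Suc K). size {#x \<in># p. Suc K < x#} = s}"
    using a b sa sb by (auto simp: p mex_parts_def initial_def sized_def parts_in_def)
qed

lemma gf_mex_parts:
  "gf sum_mset (mex_parts (Suc K)) =
     fsum (\<lambda>s. if K < s then q ^ ((K + 2) * s) * (R s * (q ^ (\<Sum>{..K}) * (Q (s - 1) * R K * R (s - 1 - K)))) else 0)"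
proof -
  have sub: "mex_parts (Suc K) \<subseteq> parts_in {0<..}" by (auto simp: mex_parts_def)
  have "size {#x \<in># p. Suc K < x#} \<le> sum_mset p" if "p \<in> mex_parts (Suc K)" for p
    using that sub size_filter_mset_lesseq size_le_sum_mset le_trans by blast
  then have "gf sum_mset (mex_parts (Suc K)) =
     fsum (\<lambda>s. gf sum_mset {p \<in> mex_parts (Suc K). size {#x \<in># p. Suc K < x#} = s})"
    using sub by (intro gf_fiber) (auto intro: graded_parts_subset)
  also have "\<dots> = fsum (\<lambda>s. gf sum_mset (initial K s) * gf sum_mset (sized (Suc (Suc K)) s))"
    unfolding mex_parts_eq
    by (subst gf_plus[where S = "{1..K}" and S' = "{Suc (Suc K)..}"])
      (auto simp: sized_def initial_def parts_in_def)
  also have "(\<lambda>s. gf sum_mset (initial K s) * gf sum_mset (sized (Suc (Suc K)) s)) =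
     (\<lambda>s. if K < s then q ^ ((K + 2) * s) * (R s * (q ^ (\<Sum>{..K}) * (Q (s - 1) * R K * R (s - 1 - K)))) else 0)"
    by (simp add: gf_initial gf_sized mult_ac fun_eq_iff)
  finally show ?thesis .
qed

lemma gf_mex_parts_shifted:
  "gf sum_mset (mex_parts (Suc K)) =
     q ^ (\<Sum>{..K}) * R K * fsum (\<lambda>t. q ^ ((K + 2) * (Suc K + t)) * (R (Suc K + t) * Q (K + t) * R t))"
proof -
  define f where "f = (\<lambda>s. if K < s then q ^ ((K + 2) * s) * (R s * (q ^ (\<Sum>{..K}) * (Q (s - 1) * R K * R (s - 1 - K)))) else 0)"
  have "small f" unfolding f_def by (intro small_if small_power) simp
  then have "fsum f = (\<Sum>s<Suc K. f s) + fsum (\<lambda>t. f (Suc K + t))"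
    by (rule fsum_shift)
  also have "(\<Sum>s<Suc K. f s) = 0" by (simp add: f_def)
  also have "(\<lambda>t. f (Suc K + t)) = (\<lambda>t. (q ^ (\<Sum>{..K}) * R K) * (q ^ ((K + 2) * (Suc K + t)) * (R (Suc K + t) * Q (K + t) * R t)))"
    by (simp add: f_def mult_ac fun_eq_iff)
  also have "fsum \<dots> = (q ^ (\<Sum>{..K}) * R K) * fsum (\<lambda>t. q ^ ((K + 2) * (Suc K + t)) * (R (Suc K + t) * Q (K + t) * R t))"
    by (intro fsum_mult small_power) simp
  finally show ?thesis
    unfolding gf_mex_parts f_def by (simp add: mult.assoc)
qed

text \<open>For \<open>K = 0\<close> the nonempty partitions without ones are counted;
  \<open>E 2\<close> is their series together with the empty one.\<close>

lemma gf_mex_1: "gf sum_mset (mex_parts 1) = (1 - q) * E 1 - 1"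
proof -
  have "R (Suc t) * Q t * R t = R (Suc t)" for t
    using Q_mult_R[of t] by (simp add: mult.assoc)
  then have "(\<lambda>t. q ^ ((0 + 2) * (Suc 0 + t)) * (R (Suc 0 + t) * Q (0 + t) * R t)) = (\<lambda>t. q ^ (2 * Suc t) * R (Suc t))"
    by (simp only: add_Suc add_0)
  then have "gf sum_mset (mex_parts 1) = fsum (\<lambda>t. q ^ (2 * Suc t) * R (Suc t))"
    using gf_mex_parts_shifted[of 0] by (simp only: R_0 One_nat_def) simp
  also have "\<dots> = E 2 - 1"
    unfolding E_def by (subst (2) fsum_Suc) (simp_all add: small_E R_0)
  also have "E 2 = (1 - q) * E 1"
    using E_Suc[of 1] by (simp add: numeral_2_eq_2)
  finally show ?thesis .
qed

text \<open>With \<open>k = Suc K\<close>, both series contain \<open>1 / (1 - q ^ (k + t))\<close>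
  once their indices are aligned; added, the numerator acquires this denominator as a factor, and
  only series of Euler type remain.\<close>

lemma gf_mex_Suc:
  "gf sum_mset (mex_parts (Suc K)) + gf sum_mset (mex_parts (Suc (Suc K))) =
     q ^ (\<Sum>{..K} + Suc K * (K + 2)) * (1 - q ^ (2 * K + 3)) * E 1"
proof -
  define k where "k = Suc K"
  \<comment> \<open>\<open>I n\<close> is \<open>1 / (1 - q ^ n)\<close> for positive
    \<open>n\<close>: \<open>Q (n - 1)\<close> cancels all but the last factor of
    \<open>R n\<close>.\<close>
  define I where "I n = R n * Q (n - 1)" for n
  have I: "(1 - q ^ n) * I n = 1" if "0 < n" for n
    using that R_Suc[of "n - 1"] Q_mult_R[of "n - 1"] by (simp add: I_def mult.assoc[symmetric] mult.commute)
  \<comment> \<open>\<open>A\<close> carries \<open>mex_parts k\<close> and \<open>B\<close> carries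
    \<open>mex_parts (Suc k)\<close>. The factor \<open>1 - q ^ t\<close> makes \<open>B 0\<close>
    vanish, which brings the shifted index of the second series in line with the first.\<close>
  define A where "A t = q ^ (Suc k * (k + t)) * (I (k + t) * R t)" for t
  define B where "B t = q ^ (Suc (Suc k) * (k + t)) * (I (k + t) * ((1 - q ^ t) * R t))" for t
  have smA: "small A" and smB: "small B"
    unfolding A_def B_def by (intro small_power; simp)+
  have 1: "gf sum_mset (mex_parts (Suc K)) = q ^ (\<Sum>{..K}) * R k * ((1 - q ^ k) * fsum A)"
    unfolding gf_mex_parts_shifted R_Suc[of K, symmetric] A_def I_def
    by (simp add: k_def mult_ac)
  have "fsum B = fsum (\<lambda>t. B (Suc t))"
    by (subst fsum_Suc[OF smB]) (simp add: B_def)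
  also have "\<dots> = fsum (\<lambda>t. q ^ ((Suc K + 2) * (Suc (Suc K) + t)) * (R (Suc (Suc K) + t) * Q (Suc K + t) * R t))"
    unfolding B_def R_Suc by (simp add: k_def I_def mult_ac)
  finally have 2: "gf sum_mset (mex_parts (Suc (Suc K))) = q ^ (\<Sum>{..K}) * R k * (q ^ k * fsum B)"
    unfolding gf_mex_parts_shifted by (simp add: k_def power_add mult_ac)
  have "(1 - q ^ k) * fsum A + q ^ k * fsum B = fsum (\<lambda>t. (1 - q ^ k) * A t + q ^ k * B t)"
    unfolding fsum_add by (simp add: fsum_mult smA smB)
  also have "\<dots> = fsum (\<lambda>t. q ^ (Suc k * k) * (1 - q ^ k) * (q ^ (Suc k * t) * R t) + q ^ (Suc k * k) * q ^ k * (q ^ (Suc (Suc k) * t) * R t))"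
  proof (intro arg_cong[where f = fsum] ext)
    fix t
    define z where "z = q ^ (Suc k * (k + t))"
    \<comment> \<open>With \<open>x = q ^ k\<close> and \<open>y = q ^ t\<close>, the numerator
      \<open>1 - x + x^2 y (1 - y)\<close> factors as
      \<open>(1 - x y) (1 - x + x y)\<close>.\<close>
    have "(1 - q ^ k) * A t + q ^ k * B t =
       z * R t * ((1 - q ^ (k + t)) * I (k + t)) * (1 + q ^ k * q ^ t - q ^ k)"
      unfolding A_def B_def z_def power_add mult_Suc distrib_left by algebra
    also have "\<dots> = z * R t * (1 - q ^ k + q ^ k * q ^ t)"
      by (subst I) (simp_all add: k_def algebra_simps)
    also have "\<dots> = q ^ (Suc k * k) * (1 - q ^ k) * (q ^ (Suc k * t) * R t) + q ^ (Suc k * k) * q ^ k * (q ^ (Suc (Suc k) * t) * R t)"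
      unfolding z_def power_add mult_Suc distrib_left by algebra
    finally show "(1 - q ^ k) * A t + q ^ k * B t = \<dots>" .
  qed
  also have "\<dots> = q ^ (Suc k * k) * (1 - q ^ k) * E (Suc k) + q ^ (Suc k * k) * q ^ k * E (Suc (Suc k))"
    unfolding fsum_add E_def by (simp add: fsum_mult small_E del: mult_Suc mult_Suc_right)
  also have "\<dots> = q ^ (Suc k * k) * (1 - q ^ k * q ^ Suc k) * E (Suc k)"
    by (simp only: E_Suc[of "Suc k", OF zero_less_Suc]) (simp add: algebra_simps)
  also have "q ^ k * q ^ Suc k = q ^ (2 * K + 3)"
  proof -
    have "k + Suc k = 2 * K + 3" by (simp add: k_def)
    then show ?thesis by (metis power_add)
  qed
  finally have "gf sum_mset (mex_parts (Suc K)) + gf sum_mset (mex_parts (Suc (Suc K))) =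
     q ^ (\<Sum>{..K}) * R k * (q ^ (Suc k * k) * (1 - q ^ (2 * K + 3)) * E (Suc k))"
    unfolding 1 2 distrib_left[symmetric] by simp
  also have "\<dots> = q ^ (\<Sum>{..K}) * q ^ (Suc k * k) * (1 - q ^ (2 * K + 3)) * (R k * E (Suc k))"
    by (simp only: mult_ac)
  also have "q ^ (\<Sum>{..K}) * q ^ (Suc k * k) = q ^ (\<Sum>{..K} + Suc K * (K + 2))"
    unfolding power_add[symmetric] by (simp add: k_def)
  finally show ?thesis unfolding R_mult_E .
qed

section \<open>The truncated pentagonal series\<close>

definition pent :: "int \<Rightarrow> nat" where "pent j = nat (j * (3 * j - 1) div 2)"

definition trunc_pent :: "nat \<Rightarrow> int fps" where
  "trunc_pent k = (\<Sum>j = 1 - int k..int k. (- 1) ^ nat \<bar>j\<bar> * q ^ pent j)"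

lemma trunc_pent_Suc:
  "trunc_pent (Suc k) = trunc_pent k + (- 1) ^ k * q ^ pent (- int k) - (- 1) ^ k * q ^ pent (int (Suc k))"
proof -
  have "{1 - int (Suc k)..int (Suc k)} = insert (- int k) (insert (int (Suc k)) {1 - int k..int k})"
    by auto
  then show ?thesis by (simp add: trunc_pent_def del: of_nat_Suc)
qed

lemma pent_eqI: "j * (3 * j - 1) = 2 * int m \<Longrightarrow> pent j = m"
  by (simp add: pent_def)

lemma sum_atMost_double: "2 * int (\<Sum>{..K}) = int K * (int K + 1)"
  by (induction K) (auto simp: algebra_simps)

text \<open>Identifies the exponent in \<open>gf_mex_Suc\<close>; with \<open>pent_pos\<close>, the
  two terms there are, up to sign, those gained by \<open>trunc_pent\<close> in one step.\<close>

lemma pent_neg: "pent (- int (Suc K)) = \<Sum>{..K} + Suc K * (K + 2)"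
  using sum_atMost_double[of K]
  by (intro pent_eqI, simp only: of_nat_add of_nat_mult distrib_left) (simp add: algebra_simps)

lemma pent_pos: "pent (int (Suc (Suc K))) = pent (- int (Suc K)) + (2 * K + 3)"
  unfolding pent_neg using sum_atMost_double[of K]
  by (intro pent_eqI, simp only: of_nat_add of_nat_mult distrib_left) (simp add: algebra_simps)

text \<open>\<open>gf_mex_Suc\<close> expresses the sum of consecutive series through the two
  pentagonal terms that extend \<open>trunc_pent\<close>, and the alternating sign turns that sum
  into a difference.\<close>

lemma andrews_merca: "(- 1) ^ K * gf sum_mset (mex_parts (Suc K)) = trunc_pent (Suc K) * E 1 - 1"
proof (induction K)
  case 0
  have "{1 - int (Suc 0)..int (Suc 0)} = {0, 1}" by auto
  then have "trunc_pent (Suc 0) = 1 - q" by (simp add: trunc_pent_def pent_def)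
  with gf_mex_1 show ?case by simp
next
  case (Suc K)
  let ?s = "(- 1) ^ K :: int fps"
  have "?s * gf sum_mset (mex_parts (Suc K)) + ?s * gf sum_mset (mex_parts (Suc (Suc K))) =
      ?s * (q ^ pent (- int (Suc K)) * (1 - q ^ (2 * K + 3)) * E 1)"
    unfolding distrib_left[symmetric] gf_mex_Suc pent_neg ..
  moreover have "trunc_pent (Suc (Suc K)) = trunc_pent (Suc K) - ?s * q ^ pent (- int (Suc K)) * (1 - q ^ (2 * K + 3))"
    unfolding trunc_pent_Suc[of "Suc K"] pent_pos power_add by (simp add: algebra_simps)
  moreover have "(- 1) ^ Suc K = - ?s" by simp
  ultimately show ?case
  proof -
    assume *: "?s * gf sum_mset (mex_parts (Suc K)) + ?s * gf sum_mset (mex_parts (Suc (Suc K))) =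
          ?s * (q ^ pent (- int (Suc K)) * (1 - q ^ (2 * K + 3)) * E 1)"
      and t: "trunc_pent (Suc (Suc K)) = trunc_pent (Suc K) - ?s * q ^ pent (- int (Suc K)) * (1 - q ^ (2 * K + 3))"
      and s: "(- 1) ^ Suc K = - ?s"
    have "(- 1) ^ Suc K * gf sum_mset (mex_parts (Suc (Suc K))) =
        (trunc_pent (Suc K) * E 1 - 1) - (?s * (q ^ pent (- int (Suc K)) * (1 - q ^ (2 * K + 3)) * E 1))"
      unfolding s *[symmetric] Suc[symmetric] by simp
    also have "\<dots> = trunc_pent (Suc (Suc K)) * E 1 - 1"
      unfolding t left_diff_distrib by (simp only: diff_diff_eq diff_diff_eq2 mult.assoc) (simp add: algebra_simps)
    finally show ?thesis .
  qed
qed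

section \<open>The crank\<close>

definition ones_large :: "nat \<Rightarrow> nat \<Rightarrow> nat multiset set" where
  "ones_large w s = {p \<in> parts_in {0<..}. count p 1 = w \<and> size {#x \<in># p. w < x#} = s}"

lemma ones_large_0: "ones_large 0 s = sized 2 s"
proof (intro equalityI subsetI)
  fix p assume p: "p \<in> ones_large 0 s"
  then have "2 \<le> x" if "x \<in># p" for x
    using that by (cases "x = 1") (auto simp: ones_large_def parts_in_def count_eq_zero_iff)
  moreover from p have "{#x \<in># p. 0 < x#} = p"
    by (auto simp: ones_large_def parts_in_def filter_mset_eq_conv)
  ultimately show "p \<in> sized 2 s"
    using p by (auto simp: ones_large_def sized_def parts_in_def)
next
  fix p assume p: "p \<in> sized 2 s"
  then have "\<And>x. x \<in># p \<Longrightarrow> 2 \<le> x" "size p = s" by (auto simp: sized_def parts_in_def)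
  moreover from this have "{#x \<in># p. 0 < x#} = p"
    by (fastforce simp: filter_mset_eq_conv)
  ultimately show "p \<in> ones_large 0 s"
    by (fastforce simp: ones_large_def parts_in_def count_eq_zero_iff)
qed

text \<open>The pieces are the ones, the parts from 2 to \<open>w\<close>, and the parts above
  \<open>w\<close>; \<open>1 \<le> w\<close> keeps the ones out of the last piece.\<close>

lemma ones_large_eq:
  assumes "1 \<le> w"
  shows "ones_large w s =
     (\<lambda>(a, b). a + b) ` ((\<lambda>p. replicate_mset w 1 + p) ` parts_in {2..w} \<times> sized (Suc w) s)"
proof (intro equalityI subsetI)
  fix p assume p: "p \<in> ones_large w s"
  then have pos: "count p 0 = 0" and w: "count p 1 = w"
    by (auto simp: ones_large_def parts_in_def count_eq_zero_iff)
  have "p = (replicate_mset w 1 + {#x \<in># p. 2 \<le> x \<and> x \<le> w#}) + {#x \<in># p. w < x#}"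
  proof (rule multiset_eqI)
    fix x :: nat
    consider "x = 0" | "x = 1" | "2 \<le> x" by linarith
    then show "count p x = count ((replicate_mset w 1 + {#x \<in># p. 2 \<le> x \<and> x \<le> w#}) + {#x \<in># p. w < x#}) x"
      by cases (use pos w assms in auto)
  qed
  moreover have "{#x \<in># p. 2 \<le> x \<and> x \<le> w#} \<in> parts_in {2..w}"
    by (auto simp: parts_in_def)
  moreover have "{#x \<in># p. w < x#} \<in> sized (Suc w) s"
    using p by (auto simp: ones_large_def sized_def parts_in_def)
  ultimately show "p \<in> (\<lambda>(a, b). a + b) ` ((\<lambda>p. replicate_mset w 1 + p) ` parts_in {2..w} \<times> sized (Suc w) s)"
    by force
next
  fix p assume "p \<in> (\<lambda>(a, b). a + b) ` ((\<lambda>p. replicate_mset w 1 + p) ` parts_in {2..w} \<times> sized (Suc w) s)"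
  then obtain a b where p: "p = replicate_mset w 1 + a + b"
    and a: "a \<in> parts_in {2..w}" and b: "b \<in> sized (Suc w) s" by auto
  have sa: "\<And>x. x \<in># a \<Longrightarrow> 2 \<le> x \<and> x \<le> w" and sb: "\<And>x. x \<in># b \<Longrightarrow> w < x" and "size b = s"
    using a b by (auto simp: sized_def parts_in_def Suc_le_eq)
  have "{#x \<in># p. w < x#} = b"
    unfolding p using sa sb assms by (intro multiset_eqI) (force simp: count_eq_zero_iff)
  moreover have "count a 1 = 0" "count b 1 = 0"
    using sa sb assms by (force simp: count_eq_zero_iff)+
  moreover have "p \<in> parts_in {0<..}"
    using sa sb by (force simp: p parts_in_def)
  ultimately show "p \<in> ones_large w s"
    using \<open>size b = s\<close> by (simp add: ones_large_def p)
qed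

text \<open>The \<open>w\<close> ones and the \<open>s\<close> parts above \<open>w\<close>
  contribute the exponent \<open>w + Suc w * s\<close>, which is the symmetric
  \<open>w + s + w * s\<close>.\<close>

lemma gf_ones_large:
  assumes "1 \<le> w"
  shows "gf sum_mset (ones_large w s) = (1 - q) * T w s"
proof -
  have "gf sum_mset ((\<lambda>p. replicate_mset w 1 + p) ` parts_in {2..w}) = q ^ w * ((1 - q) * R w)"
    using assms by (subst gf_image[where c = w and v = sum_mset]) (auto simp: inj_on_def gf_parts_from_2)
  moreover have "gf sum_mset (ones_large w s) =
      gf sum_mset ((\<lambda>p. replicate_mset w 1 + p) ` parts_in {2..w}) * gf sum_mset (sized (Suc w) s)"
    unfolding ones_large_eq[OF assms]
    by (rule gf_plus[where S = "{1..w}" and S' = "{Suc w..}"])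
      (use assms in \<open>auto simp: sized_def parts_in_def split: if_splits\<close>)
  ultimately show ?thesis
    by (simp add: gf_sized T_def power_add mult_ac)
qed

section \<open>The sign of the crank\<close>

lemma crank_pos_count: "1 \<le> count p 1 \<Longrightarrow> crank p = int (size {#x \<in># p. count p 1 < x#}) - int (count p 1)"
proof -
  assume "1 \<le> count p 1"
  then have "count p 1 \<noteq> 0" by linarith
  moreover from this have "p \<noteq> {#}" by auto
  ultimately show ?thesis by (simp only: crank_def if_False)
qed

lemma crank_count_0: 
  assumes "p \<in> parts_in {0<..}" "count p 1 = 0"
  shows "crank p = 0 \<longleftrightarrow> p = {#}" "0 < crank p \<longleftrightarrow> p \<noteq> {#}"
proof -
  have "0 < Max (set_mset p)" if "p \<noteq> {#}"
    using that assms(1) Max_in[of "set_mset p"] by (auto simp: parts_in_def simp del: Max_in)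
  then show "crank p = 0 \<longleftrightarrow> p = {#}" "0 < crank p \<longleftrightarrow> p \<noteq> {#}"
    using assms(2) by (auto simp: crank_def)
qed

text \<open>For \<open>w = 0\<close> the crank is the largest part and not \<open>s - w\<close>, but
  both are positive exactly when \<open>p\<close> is nonempty.\<close>

lemma crank_ones_large:
  assumes "p \<in> ones_large w s"
  shows "0 < crank p \<longleftrightarrow> w < s" "crank p = 0 \<longleftrightarrow> s = w"
proof -
  have "(0 < crank p \<longleftrightarrow> w < s) \<and> (crank p = 0 \<longleftrightarrow> s = w)"
  proof (cases "w = 0")
    case True
    have "size p = s" using assms True ones_large_0[of s] by (simp add: sized_def)
    moreover have "p \<in> parts_in {0<..}" "count p 1 = 0"
      using assms True by (simp_all add: ones_large_def)
    ultimately show ?thesis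
      using crank_count_0[of p] True by (auto simp: nonempty_has_size[symmetric])
  next
    case False
    with assms show ?thesis
      by (auto simp: ones_large_def crank_pos_count)
  qed
  then show "0 < crank p \<longleftrightarrow> w < s" "crank p = 0 \<longleftrightarrow> s = w" by auto
qed

lemma gf_fiber_ones_large:
  assumes "A \<subseteq> parts_in {0<..}"
  shows "gf sum_mset A = fsum (\<lambda>w. fsum (\<lambda>s. gf sum_mset (A \<inter> ones_large w s)))"
proof -
  have le: "count p x \<le> sum_mset p" "size (filter_mset P p) \<le> sum_mset p" if "p \<in> A" for p x P
    using that assms size_le_sum_mset[of p] count_le_size[of p x] size_filter_mset_lesseq[of P p]
    by (meson le_trans subsetD)+
  have "gf sum_mset A = fsum (\<lambda>w. gf sum_mset {p \<in> A. count p 1 = w})"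
    using assms le by (intro gf_fiber graded_parts_subset) auto
  also have "\<dots> = fsum (\<lambda>w. fsum (\<lambda>s. gf sum_mset {p \<in> {p \<in> A. count p 1 = w}. size {#x \<in># p. w < x#} = s}))"
    using assms le
    by (intro arg_cong[where f = fsum] ext gf_fiber graded_parts_subset[where S = "{0<..}"]) auto
  also have "\<dots> = fsum (\<lambda>w. fsum (\<lambda>s. gf sum_mset (A \<inter> ones_large w s)))"
    using assms by (intro arg_cong[where f = fsum] ext arg_cong[where f = "gf sum_mset"]) (auto simp: ones_large_def)
  finally show ?thesis .
qed

lemma small_T: "small (T w)"
  unfolding T_def by (intro small_power) simp

text \<open>The corrections by \<open>q\<close> below are absorbed by the conventional values at \<open>n = 1\<close>.\<close>

lemma gf_crank_pos: "gf sum_mset {p \<in> parts_in {0<..}. 0 < crank p} = C0 - q"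
proof -
  define A where "A = {p \<in> parts_in {0<..}. 0 < crank p}"
  have A_Int: "A \<inter> ones_large w s = (if w < s then ones_large w s else {})" for w s
    using crank_ones_large by (auto simp: A_def) (auto simp: ones_large_def)
  have "gf sum_mset A = fsum (\<lambda>w. fsum (\<lambda>s. gf sum_mset (A \<inter> ones_large w s)))"
    by (rule gf_fiber_ones_large) (auto simp: A_def)
  also have "\<dots> = fsum (\<lambda>w. (1 - q) * fsum (\<lambda>s. if w < s then T w s else 0) - (if w = 0 then q else 0))"
  proof (intro arg_cong[where f = fsum] ext)
    fix w
    show "fsum (\<lambda>s. gf sum_mset (A \<inter> ones_large w s)) =
        (1 - q) * fsum (\<lambda>s. if w < s then T w s else 0) - (if w = 0 then q else 0)"
    proof (cases "w = 0")
      case True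
      have pos: "fsum (\<lambda>s. if 0 < s then f s else 0) = fsum f - f 0" if "small f" for f
        using that by (subst (1 2) fsum_Suc) (auto intro: small_if)
      have "fsum (\<lambda>s. gf sum_mset (A \<inter> ones_large w s)) = fsum (\<lambda>s. if 0 < s then q ^ (2 * s) * R s else 0)"
        unfolding True A_Int by (intro arg_cong[where f = fsum] ext) (auto simp: ones_large_0 gf_sized)
      also have "\<dots> = E 2 - 1"
        unfolding E_def by (subst pos) (simp_all add: small_E R_0)
      \<comment> \<open>Removing the term \<open>s = 0\<close> from \<open>(1 - q) * E 1\<close>
        takes away \<open>1 - q\<close> instead of 1; hence the correction by
        \<open>q\<close>.\<close>
      also have "\<dots> = (1 - q) * (E 1 - 1) - q"
        using E_Suc[of 1] by (simp add: numeral_2_eq_2 algebra_simps)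
      also have "E 1 - 1 = fsum (\<lambda>s. if 0 < s then T 0 s else 0)"
        unfolding pos[OF small_T] fsum_T by (simp add: T_def R_0)
      finally show ?thesis unfolding True by simp
    next
      case False
      then have "fsum (\<lambda>s. gf sum_mset (A \<inter> ones_large w s)) = fsum (\<lambda>s. (1 - q) * (if w < s then T w s else 0))"
        unfolding A_Int by (intro arg_cong[where f = fsum] ext) (simp add: gf_ones_large)
      with False show ?thesis
        by (simp add: fsum_mult small_if small_T)
    qed
  qed
  also have "\<dots> = C0 - fsum (\<lambda>w. if w = 0 then q else 0)"
  proof -
    have "small (\<lambda>w. fsum (\<lambda>s. if w < s then T w s else 0))"
      unfolding small_def fsum_def
      by (auto simp: T_def fps_X_power_mult_nth intro!: sum.neutral)
    then show ?thesis unfolding fsum_diff C0_def by (simp add: fsum_mult)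
  qed
  also have "fsum (\<lambda>w. if w = 0 then q else 0) = q"
    by (rule fps_ext) (simp add: fsum_def if_distrib[of "\<lambda>f. f $ _"] cong: if_cong)
  finally show ?thesis unfolding A_def .
qed

lemma gf_crank_zero: "gf sum_mset {p \<in> parts_in {0<..}. crank p = 0} = C2 + q"
proof -
  define A where "A = {p \<in> parts_in {0<..}. crank p = 0}"
  have A_Int: "A \<inter> ones_large w s = (if s = w then ones_large w w else {})" for w s
    using crank_ones_large by (auto simp: A_def) (auto simp: ones_large_def)
  have diag: "fsum (\<lambda>s. if s = w then f else 0) = f" if "\<And>n. n < w \<Longrightarrow> f $ n = 0" for w f
  proof (rule fps_ext)
    fix n
    show "fsum (\<lambda>s. if s = w then f else 0) $ n = f $ n"
      using that[of n] by (simp add: fsum_def if_distrib[of "\<lambda>f. f $ n"] cong: if_cong)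
  qed
  have "gf sum_mset A = fsum (\<lambda>w. fsum (\<lambda>s. gf sum_mset (A \<inter> ones_large w s)))"
    by (rule gf_fiber_ones_large) (auto simp: A_def)
  also have "\<dots> = fsum (\<lambda>w. (1 - q) * T w w + (if w = 0 then q else 0))"
  proof (intro arg_cong[where f = fsum] ext)
    fix w
    \<comment> \<open>For \<open>w = 0\<close> only the empty partition is counted, while
      \<open>(1 - q) * T 0 0 = 1 - q\<close>.\<close>
    have "gf sum_mset (ones_large w w) = (1 - q) * T w w + (if w = 0 then q else 0)"
      by (cases "w = 0") (auto simp: ones_large_0 gf_sized gf_ones_large T_def R_0)
    then have *: "gf sum_mset (A \<inter> ones_large w s) = (if s = w then (1 - q) * T w w + (if w = 0 then q else 0) else 0)" for s
      unfolding A_Int by simp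
    have "(1 - q) * T w w = q ^ w * ((1 - q) * q ^ (w + w * w) * (R w * R w))"
      by (simp add: T_def power_add mult_ac)
    then have "((1 - q) * T w w) $ n = 0" if "n < w" for n
      using that by (simp only: fps_X_power_mult_nth if_True)
    then show "fsum (\<lambda>s. gf sum_mset (A \<inter> ones_large w s)) = (1 - q) * T w w + (if w = 0 then q else 0)"
      unfolding * by (intro diag) simp
  qed
  also have "\<dots> = C2 + q"
  proof -
    have "small (\<lambda>w. T w w)"
      unfolding T_def by (intro small_power) simp
    then show ?thesis unfolding fsum_add C2_def by (simp add: fsum_mult diag)
  qed
  finally show ?thesis unfolding A_def .
qed

lemma finite_partitions: "finite (partitions n)"
  using graded_parts unfolding partitions_eq graded_def by blast

text \<open>The corrections by \<open>q\<close> affect only \<open>n = 1\<close>, where the sole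
  partition has crank -1 and falls under none of the three conditions; this yields the conventional
  values 1, 0 and -1.\<close>

lemma gf_crank:
  "Abs_fps (crank_count 0) = C0" "Abs_fps (crank_count 1) = C0 + C2" "Abs_fps (crank_count 2) = C2"
proof -
  have part: "{p \<in> partitions n. P (crank p)} = {p \<in> {p \<in> parts_in {0<..}. P (crank p)}. sum_mset p = n}" for n P
    unfolding partitions_eq by auto
  have pos: "int (card {p \<in> partitions n. 0 < crank p}) = (C0 - q) $ n"
    and zero: "int (card {p \<in> partitions n. crank p = 0}) = (C2 + q) $ n" for n
    unfolding part[where P = "\<lambda>c. 0 < c"] part[where P = "\<lambda>c. c = 0"] gf_crank_pos[symmetric] gf_crank_zero[symmetric]
    by (simp_all add: gf_def)
  have one: "{p \<in> partitions 1. P (crank p)} = (if P (- 1) then {{#1#}} else {})" for P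
  proof -
    have "p = {#1#}" if "p \<in> partitions 1" for p
    proof -
      from that have p: "p \<in> parts_in {0<..}" "sum_mset p = 1"
        by (simp_all add: partitions_eq)
      then have "size p \<le> 1" using size_le_sum_mset by metis
      moreover have "p \<noteq> {#}" using p by auto
      ultimately have "size p = 1" by (simp add: le_Suc_eq)
      then obtain x where "p = {#x#}" by (metis size_1_singleton_mset)
      with p show ?thesis by simp
    qed
    moreover have "{#1#} \<in> partitions 1" by (auto simp: partitions_def)
    moreover have "crank {#1#} = - 1" by (simp add: crank_def)
    ultimately have "p \<in> partitions 1 \<and> P (crank p) \<longleftrightarrow> p = {#1#} \<and> P (- 1)" for p by metis
    then show ?thesis by auto
  qed
  have q: "q $ n = (if n = 1 then 1 else 0)" for n
    by (simp add: fps_X_nth)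
  have 0: "crank_count 0 n = C0 $ n" and 2: "crank_count 2 n = C2 $ n" for n
  proof -
    have "card {p \<in> partitions 1. 0 < crank p} = 0" "card {p \<in> partitions 1. crank p = 0} = 0"
      unfolding one[of "\<lambda>c. 0 < c"] one[of "\<lambda>c. c = 0"] by simp_all
    then show "crank_count 0 n = C0 $ n" "crank_count 2 n = C2 $ n"
      using pos[of n] zero[of n] by (cases "n = 1"; simp add: crank_count_def q)+
  qed
  have "card {p \<in> partitions n. 0 \<le> crank p} = card {p \<in> partitions n. 0 < crank p} + card {p \<in> partitions n. crank p = 0}" for n
    by (subst card_Un_disjoint[symmetric]) (auto simp: finite_partitions intro!: arg_cong[where f = card])
  then have "crank_count 1 n = crank_count 0 n + crank_count 2 n" for n
    by (simp add: crank_count_def)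
  with 0 2 show "Abs_fps (crank_count 0) = C0" "Abs_fps (crank_count 1) = C0 + C2" "Abs_fps (crank_count 2) = C2"
    by (auto intro!: fps_ext)
qed

section \<open>Unimodal compositions\<close>

text \<open>\<open>M\<close> is meant to stand at its first occurrence: \<open>A\<close> is used
  with smaller parts only, and further copies of the maximum go into \<open>B\<close>.\<close>

definition peak :: "nat \<Rightarrow> nat multiset \<times> nat multiset \<Rightarrow> nat list" where
  "peak M = (\<lambda>(A, B). sorted_list_of_multiset A @ M # rev (sorted_list_of_multiset B))"

text \<open>The first entry equal to \<open>Suc N\<close> separates the two halves and so recovers
  them.\<close>

lemma inj_on_peak: "inj_on (peak (Suc N)) (parts_in {1..N} \<times> UNIV)"
proof (rule inj_on_inverseI[where g = "\<lambda>xs. (mset (takeWhile (\<lambda>x. x \<noteq> Suc N) xs), mset (tl (dropWhile (\<lambda>x. x \<noteq> Suc N) xs)))"])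
  fix x :: "nat multiset \<times> nat multiset" assume "x \<in> parts_in {1..N} \<times> UNIV"
  then obtain A B where x: "x = (A, B)" and "A \<in> parts_in {1..N}" by auto
  from this(2) have *: "\<And>x. x \<in> set (sorted_list_of_multiset A) \<Longrightarrow> x \<noteq> Suc N"
    by (auto simp: parts_in_def)
  have "takeWhile (\<lambda>x. x \<noteq> Suc N) (peak (Suc N) (A, B)) = sorted_list_of_multiset A"
    unfolding peak_def prod.case using * by (subst takeWhile_append2) auto
  moreover have "dropWhile (\<lambda>x. x \<noteq> Suc N) (peak (Suc N) (A, B)) = Suc N # rev (sorted_list_of_multiset B)"
    unfolding peak_def prod.case using * by (subst dropWhile_append2) auto
  ultimately show "(mset (takeWhile (\<lambda>x. x \<noteq> Suc N) (peak (Suc N) x)),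
      mset (tl (dropWhile (\<lambda>x. x \<noteq> Suc N) (peak (Suc N) x)))) = x"
    unfolding x by simp
qed

definition unimodals :: "nat list set" where
  "unimodals = {xs. (\<forall>x\<in>set xs. 0 < x) \<and> unimodal xs}"

lemma unimodal_append:
  assumes "sorted (ls @ [M])" "sorted_wrt (\<ge>) (M # rs)"
  shows "unimodal (ls @ M # rs)"
  unfolding unimodal_def using assms
  by (intro bexI[of _ "Suc (length ls)"]) auto

text \<open>The position \<open>t\<close> in the definition is ambiguous when the maximum repeats;
  taking the first occurrence makes the splitting canonical.\<close>

lemma unimodal_split:
  assumes "unimodal xs"
  obtains ls M rs where "xs = ls @ M # rs" "M \<notin> set ls" "sorted (ls @ [M])" "sorted_wrt (\<ge>) (M # rs)"
proof -
  obtain t where t: "1 \<le> t" "t \<le> length xs" and up: "sorted (take t xs)" and down: "sorted_wrt (\<ge>) (drop (t - 1) xs)"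
    using assms by (auto simp: unimodal_def)
  define M where "M = xs ! (t - 1)"
  have "M \<in> set xs" using t by (simp add: M_def)
  then obtain ls rs where xs: "xs = ls @ M # rs" and M: "M \<notin> set ls"
    using split_list_first by metis
  have len: "length ls \<le> t - 1"
  proof (rule ccontr)
    assume "\<not> length ls \<le> t - 1"
    then have "ls ! (t - 1) \<in> set ls" "xs ! (t - 1) = ls ! (t - 1)"
      by (simp_all add: xs nth_append)
    with M show False by (simp add: M_def)
  qed
  have "sorted (ls @ [M])"
  proof -
    have "take (Suc (length ls)) (take t xs) = ls @ [M]"
      using len t by (simp add: xs min_def)
    then show ?thesis using up by (metis sorted_wrt_take)
  qed
  moreover have "sorted_wrt (\<ge>) (M # rs)"
    unfolding sorted_wrt_iff_nth_less
  proof (intro allI impI)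
    have nth: "(M # rs) ! i = xs ! (length ls + i)" for i
      by (simp add: xs nth_append)
    have le: "xs ! j \<le> xs ! i" if "t - 1 \<le> i" "i \<le> j" "j < length xs" for i j
    proof (cases "i = j")
      case False
      with that down have "drop (t - 1) xs ! (i - (t - 1)) \<ge> drop (t - 1) xs ! (j - (t - 1))"
        unfolding sorted_wrt_iff_nth_less by (elim allE[of _ "i - (t - 1)"] allE[of _ "j - (t - 1)"]) auto
      with that show ?thesis by simp
    qed simp
    have up': "xs ! i \<le> xs ! j" if "i \<le> j" "j \<le> t - 1" for i j
    proof -
      have "take t xs ! i \<le> take t xs ! j"
        using that t by (intro sorted_nth_mono[OF up]) auto
      with that t show ?thesis by simp
    qed
    fix i j assume ij: "i < j" "j < length (M # rs)"
    let ?i = "length ls + i" and ?j = "length ls + j"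
    have j: "?j < length xs" using ij by (simp add: xs)
    show "(M # rs) ! j \<le> (M # rs) ! i"
    proof (cases "t - 1 \<le> ?i")
      case True
      with ij j show ?thesis unfolding nth by (intro le) auto
    next
      case False
      \<comment> \<open>Position \<open>?i\<close> lies between the first \<open>M\<close> and the
        index \<open>t - 1\<close>, so its entry is at least \<open>M\<close>; no entry exceeds
        \<open>M\<close>.\<close>
      then have "M \<le> xs ! ?i"
        using up'[of "length ls" ?i] by (simp add: xs nth_append)
      moreover have "xs ! ?j \<le> M"
        unfolding M_def using le[of "t - 1" ?j] up'[of ?j "t - 1"] j by linarith
      ultimately show ?thesis unfolding nth by simp
    qed
  qed
  ultimately show ?thesis using that xs M by blast
qed

lemma peak_unimodals:
  assumes "A \<in> parts_in {1..N}" "B \<in> parts_in {1..Suc N}"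
  shows "peak (Suc N) (A, B) \<in> unimodals" "Max (set (peak (Suc N) (A, B))) = Suc N"
proof -
  have A: "\<And>x. x \<in># A \<Longrightarrow> 0 < x \<and> x \<le> N" and B: "\<And>x. x \<in># B \<Longrightarrow> 0 < x \<and> x \<le> Suc N"
    using assms by (force simp: parts_in_def)+
  have "sorted (sorted_list_of_multiset A @ [Suc N])"
    using A by (auto simp: sorted_append intro: le_SucI)
  moreover have "sorted_wrt (\<ge>) (Suc N # rev (sorted_list_of_multiset B))"
    using B by (simp add: sorted_wrt_rev)
  ultimately have "unimodal (peak (Suc N) (A, B))"
    unfolding peak_def prod.case by (rule unimodal_append)
  with A B show "peak (Suc N) (A, B) \<in> unimodals"
    by (auto simp: unimodals_def peak_def)
  show "Max (set (peak (Suc N) (A, B))) = Suc N"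
    using A B by (intro Max_eqI) (auto simp: peak_def intro: le_SucI)
qed

lemma unimodals_peak:
  assumes "xs \<in> unimodals" "Max (set xs) = Suc N"
  obtains A B where "xs = peak (Suc N) (A, B)" "A \<in> parts_in {1..N}" "B \<in> parts_in {1..Suc N}"
proof -
  obtain ls M rs where xs: "xs = ls @ M # rs" and M: "M \<notin> set ls"
    and up: "sorted (ls @ [M])" and down: "sorted_wrt (\<ge>) (M # rs)"
    using assms(1) by (auto simp: unimodals_def elim: unimodal_split)
  have "Max (set xs) = M"
    by (intro Max_eqI) (use up down in \<open>auto simp: xs sorted_append\<close>)
  with assms(2) have MN: "M = Suc N" by simp
  have "sorted_list_of_multiset (mset ls) = ls" "rev (sorted_list_of_multiset (mset rs)) = rs"
  proof -
    have "sorted ls" using up by (simp add: sorted_append)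
    then show "sorted_list_of_multiset (mset ls) = ls"
      by (simp add: sorted_sort_id)
    have "sorted (rev rs)" using down by (simp add: sorted_wrt_rev)
    then have "sort rs = rev rs"
      by (metis mset_rev properties_for_sort)
    then show "rev (sorted_list_of_multiset (mset rs)) = rs" by simp
  qed
  then have "xs = peak (Suc N) (mset ls, mset rs)"
    by (simp add: peak_def xs MN)
  moreover have pos: "\<forall>x\<in>set xs. 0 < x" using assms(1) by (simp add: unimodals_def)
  have "mset ls \<in> parts_in {1..N}"
  proof -
    have "x \<le> N" if "x \<in> set ls" for x
      using that M up by (cases "x = Suc N") (auto simp: sorted_append MN le_Suc_eq)
    with pos show ?thesis by (auto simp: parts_in_def xs Suc_le_eq)
  qed
  moreover have "mset rs \<in> parts_in {1..Suc N}"
    using pos down by (auto simp: parts_in_def xs MN Suc_le_eq)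
  ultimately show ?thesis using that by blast
qed

section \<open>Generating functions from the splitting at the peak\<close>

lemma gf_peak:
  assumes "A \<subseteq> parts_in {1..N}" "B \<subseteq> parts_in {1..Suc N}"
  shows "gf sum_list (peak (Suc N) ` (A \<times> B)) = q ^ Suc N * (gf sum_mset A * gf sum_mset B)"
proof -
  have sum: "sum_list (sorted_list_of_multiset C) = sum_mset C" for C :: "nat multiset"
    by (metis mset_sorted_list_of_multiset sum_mset_sum_list)
  have "gf sum_list (peak (Suc N) ` (A \<times> B)) = q ^ Suc N * gf (\<lambda>(a, b). sum_mset a + sum_mset b) (A \<times> B)"
    by (rule gf_image, rule inj_on_subset[OF inj_on_peak]) (use assms in \<open>auto simp: peak_def sum\<close>)
  also have "gf (\<lambda>(a, b). sum_mset a + sum_mset b) (A \<times> B) = gf sum_mset A * gf sum_mset B"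
    by (intro gf_times graded_parts_subset[OF assms(1)] graded_parts_subset[OF assms(2)]) auto
  finally show ?thesis .
qed

lemma graded_unimodals: "graded sum_list unimodals"
  unfolding graded_def
proof
  fix n
  have "length xs \<le> sum_list xs" if "\<forall>x\<in>set xs. 0 < x" for xs :: "nat list"
    using that by (induction xs) auto
  then have "{xs \<in> unimodals. sum_list xs = n} \<subseteq> {xs. set xs \<subseteq> {..n} \<and> length xs \<le> n}"
    by (auto simp: unimodals_def intro: member_le_sum_list)
  then show "finite {xs \<in> unimodals. sum_list xs = n}"
    by (rule finite_subset) (simp add: finite_lists_length_le)
qed

lemma unimodals_nonempty: "xs \<in> unimodals \<Longrightarrow> 0 < Max (set xs) \<and> Max (set xs) \<le> sum_list xs"
proof -
  assume xs: "xs \<in> unimodals"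
  then have "xs \<noteq> []" by (auto simp: unimodals_def unimodal_def)
  then have "Max (set xs) \<in> set xs" by (intro Max_in) auto
  with xs show ?thesis by (auto simp: unimodals_def intro: member_le_sum_list)
qed

text \<open>The fibre index is the maximum minus 1; as the maximum is positive, nothing is lost by
  this subtraction.\<close>

lemma gf_fiber_unimodals:
  assumes "A \<subseteq> unimodals"
  shows "gf sum_list A = fsum (\<lambda>N. gf sum_list {xs \<in> A. Max (set xs) = Suc N})"
proof -
  have "gf sum_list A = fsum (\<lambda>N. gf sum_list {xs \<in> A. Max (set xs) - 1 = N})"
    by (intro gf_fiber graded_subset[OF graded_unimodals assms])
      (use assms unimodals_nonempty in \<open>fastforce intro: le_trans[OF diff_le_self]\<close>)
  also have "\<dots> = fsum (\<lambda>N. gf sum_list {xs \<in> A. Max (set xs) = Suc N})"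
    using assms unimodals_nonempty
    by (intro arg_cong[where f = fsum] ext arg_cong[where f = "gf sum_list"]) (fastforce simp: gr0_conv_Suc)
  finally show ?thesis .
qed

lemma gf_unimodals: "gf sum_list unimodals = U0"
proof -
  have "{xs \<in> unimodals. Max (set xs) = Suc N} = peak (Suc N) ` (parts_in {1..N} \<times> parts_in {1..Suc N})" for N
    using peak_unimodals by (auto elim!: unimodals_peak)
  then show ?thesis
    unfolding gf_fiber_unimodals[OF order_refl] U0_def by (simp only: gf_peak[OF order_refl order_refl] R_def)
qed

text \<open>Of the \<open>m\<close> copies of the maximum one is the peak and \<open>m - 1\<close>
  lie in the right half; without them both halves have parts up to \<open>N\<close>.\<close>

lemma gf_unimodals_max_count:
  assumes "1 \<le> m"
  shows "gf sum_list {xs \<in> unimodals. count_list xs (Max (set xs)) = m} = q ^ m * fsum (\<lambda>N. q ^ (m * N) * (R N)\<^sup>2)"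
proof -
  let ?U = "{xs \<in> unimodals. count_list xs (Max (set xs)) = m}"
  have "gf sum_list {xs \<in> ?U. Max (set xs) = Suc N} = q ^ m * (q ^ (m * N) * (R N)\<^sup>2)" for N
  proof -
    define B where "B = {p \<in> parts_in {1..Suc N}. count p (Suc N) = m - 1}"
    have count: "count_list (peak (Suc N) (a, b)) (Suc N) = Suc (count b (Suc N))" if "a \<in> parts_in {1..N}" for a b
    proof -
      have "count_list xs x = count (mset xs) x" for xs and x :: nat
        by (simp add: count_mset)
      moreover have "count a (Suc N) = 0" using that by (auto simp: parts_in_def count_eq_zero_iff)
      ultimately show ?thesis by (simp add: peak_def)
    qed
    have "{xs \<in> ?U. Max (set xs) = Suc N} = peak (Suc N) ` (parts_in {1..N} \<times> B)"
    proof (intro equalityI subsetI)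
      fix xs assume xs: "xs \<in> {xs \<in> ?U. Max (set xs) = Suc N}"
      then obtain a b where "xs = peak (Suc N) (a, b)" "a \<in> parts_in {1..N}" "b \<in> parts_in {1..Suc N}"
        by (auto elim: unimodals_peak)
      with xs count show "xs \<in> peak (Suc N) ` (parts_in {1..N} \<times> B)"
        by (auto simp: B_def)
    next
      fix xs assume "xs \<in> peak (Suc N) ` (parts_in {1..N} \<times> B)"
      then show "xs \<in> {xs \<in> ?U. Max (set xs) = Suc N}"
        using assms by (auto simp: B_def peak_unimodals count)
    qed
    moreover have "gf sum_mset B = q ^ ((m - 1) * Suc N) * R N"
    proof -
      have "B = (\<lambda>p. replicate_mset (m - 1) (Suc N) + p) ` parts_in {1..N}"
      proof (intro equalityI subsetI)
        fix p assume p: "p \<in> B"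
        have "p = replicate_mset (m - 1) (Suc N) + {#x \<in># p. x \<noteq> Suc N#}"
          using p by (auto simp: B_def multiset_eq_iff)
        moreover have "{#x \<in># p. x \<noteq> Suc N#} \<in> parts_in {1..N}"
          using p by (auto simp: B_def parts_in_def subset_iff le_Suc_eq)
        ultimately show "p \<in> (\<lambda>p. replicate_mset (m - 1) (Suc N) + p) ` parts_in {1..N}" by blast
      next
        fix p assume "p \<in> (\<lambda>p. replicate_mset (m - 1) (Suc N) + p) ` parts_in {1..N}"
        then obtain p' where p': "p = replicate_mset (m - 1) (Suc N) + p'" "set_mset p' \<subseteq> {1..N}"
          by (auto simp: parts_in_def)
        then have "count p' (Suc N) = 0" by (auto simp: count_eq_zero_iff)
        with p' show "p \<in> B" by (fastforce simp: B_def parts_in_def split: if_splits)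
      qed
      then show ?thesis
        by (simp only: R_def) (rule gf_image, auto simp: inj_on_def)
    qed
    ultimately have "gf sum_list {xs \<in> ?U. Max (set xs) = Suc N} = q ^ Suc N * (R N * (q ^ ((m - 1) * Suc N) * R N))"
      using gf_peak[of "parts_in {1..N}" N B] by (simp only: R_def[symmetric]) (auto simp: B_def)
    also have "\<dots> = q ^ (Suc N + (m - 1) * Suc N) * (R N)\<^sup>2"
      by (simp only: power_add power2_eq_square mult_ac)
    also have "Suc N + (m - 1) * Suc N = m + m * N"
      using assms by (cases m) auto
    finally show ?thesis by (simp only: power_add mult_ac)
  qed
  then have "gf sum_list ?U = fsum (\<lambda>N. q ^ m * (q ^ (m * N) * (R N)\<^sup>2))"
    by (subst gf_fiber_unimodals) auto
  also have "\<dots> = q ^ m * fsum (\<lambda>N. q ^ (m * N) * (R N)\<^sup>2)"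
    using assms by (intro fsum_mult small_E) simp
  finally show ?thesis .
qed

section \<open>Passage to coefficients\<close>

lemma compositions_unimodal: "{xs \<in> compositions n. unimodal xs} = {xs \<in> unimodals. sum_list xs = n}"
  by (auto simp: compositions_def unimodals_def)

lemma unimodal_count_0: "int (unimodal_count 0 (int n)) = U0 $ n"
proof (cases "n = 0")
  case True
  \<comment> \<open>The factor \<open>q ^ Suc N\<close> agrees with the convention
    \<open>u_0(0) = 0\<close>.\<close>
  have "U0 $ 0 = 0" by (simp add: U0_def fsum_def)
  with True show ?thesis by (simp add: unimodal_count_def)
next
  case False
  then show ?thesis
    by (simp add: unimodal_count_def compositions_unimodal gf_unimodals[symmetric] gf_def)
qed

lemma unimodal_count_pos:
  assumes "1 \<le> m"
  shows "int (unimodal_count m (int n)) = fsum (\<lambda>N. q ^ (m * N) * (R N)\<^sup>2) $ n"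
proof -
  have "int (unimodal_count m (int n)) = gf sum_list {xs \<in> unimodals. count_list xs (Max (set xs)) = m} $ (n + m)"
    using assms by (auto simp: unimodal_count_def gf_def compositions_def unimodals_def intro!: arg_cong[where f = card])
  then show ?thesis
    unfolding gf_unimodals_max_count[OF assms] by (simp add: fps_X_power_mult_nth)
qed

lemma gf_unimodal_count:
  assumes "m \<in> {0, 1, 2}"
  shows "Abs_fps (\<lambda>n. int (unimodal_count m (int n))) = E 1 * Abs_fps (crank_count m)"
proof -
  have "Abs_fps (\<lambda>n. int (unimodal_count 0 (int n))) = U0"
    by (rule fps_ext) (simp add: unimodal_count_0)
  moreover have "Abs_fps (\<lambda>n. int (unimodal_count 1 (int n))) = U1"
    by (rule fps_ext) (simp add: unimodal_count_pos U1_def del: One_nat_def)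
  moreover have "Abs_fps (\<lambda>n. int (unimodal_count 2 (int n))) = U2"
    by (rule fps_ext) (simp add: unimodal_count_pos U2_def)
  moreover have "U1 = E 1 * (C0 + C2)"
    by (simp add: U1_eq U0_C0 U2_C2 distrib_left)
  ultimately show ?thesis
    using assms by (auto simp: gf_crank[unfolded One_nat_def] U0_C0 U2_C2)
qed

lemma gf_mex_count: "Abs_fps (\<lambda>n. int (mex_count k n)) = gf sum_mset (mex_parts k)"
  by (rule fps_ext) (auto simp: mex_count_def gf_def mex_parts_def mex_def partitions_eq intro!: arg_cong[where f = card])

text \<open>Terms with \<open>pent j > n\<close> vanish on the left because the shifted series
  starts later, on the right by the assumption on negative arguments.\<close>

lemma trunc_pent_mult_nth:
  fixes u :: "int \<Rightarrow> nat"
  assumes "\<And>i. i < 0 \<Longrightarrow> u i = 0"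
  shows "(trunc_pent k * Abs_fps (\<lambda>n. int (u (int n)))) $ n =
     (\<Sum>j = 1 - int k..int k. (- 1) ^ nat \<bar>j\<bar> * int (u (int n - j * (3 * j - 1) div 2)))"
  unfolding trunc_pent_def sum_distrib_right fps_sum_nth
proof (intro sum.cong refl)
  fix j :: int
  have "0 \<le> j * (3 * j - 1)"
    by (cases "0 < j") (auto intro: mult_nonneg_nonneg mult_nonpos_nonpos)
  then have pent: "j * (3 * j - 1) div 2 = int (pent j)"
    by (simp add: pent_def)
  have "((- 1) ^ nat \<bar>j\<bar> * q ^ pent j * Abs_fps (\<lambda>n. int (u (int n)))) $ n =
      (- 1) ^ nat \<bar>j\<bar> * (q ^ pent j * Abs_fps (\<lambda>n. int (u (int n)))) $ n"
    by (cases "even (nat \<bar>j\<bar>)") simp_all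
  also have "(q ^ pent j * Abs_fps (\<lambda>n. int (u (int n)))) $ n = int (u (int n - int (pent j)))"
    using assms by (simp add: fps_X_power_mult_nth of_nat_diff)
  finally show "((- 1) ^ nat \<bar>j\<bar> * q ^ pent j * Abs_fps (\<lambda>n. int (u (int n)))) $ n =
      (- 1) ^ nat \<bar>j\<bar> * int (u (int n - j * (3 * j - 1) div 2))"
    unfolding pent .
qed

theorem theorem1p2:
  fixes k n m :: nat
  assumes "k \<ge> 1" and "n \<ge> 1" and "m \<in> {0, 1, 2}"
  shows "(- 1) ^ k *
           (crank_count m n -
            (\<Sum>j = 1 - int k..int k.
               (- 1) ^ nat \<bar>j\<bar> * int (unimodal_count m (int n - j * (3 * j - 1) div 2))))
         = (\<Sum>j = 0..n. crank_count m j * int (mex_count k (n - j)))"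
proof -
  obtain K where k: "k = Suc K" using assms(1) by (cases k) auto
  define C where "C = Abs_fps (crank_count m)"
  define U where "U = Abs_fps (\<lambda>n. int (unimodal_count m (int n)))"
  define M where "M = gf sum_mset (mex_parts k)"
  have sign: "(- 1) ^ K * (- 1) ^ K = (1 :: int fps)"
    by (simp flip: power_mult_distrib)
  \<comment> \<open>The inserted square of the sign exposes \<open>(- 1) ^ K * M\<close>, the left
    side of \<open>andrews_merca\<close>; then \<open>E 1 * C\<close> becomes \<open>U\<close>, and
    \<open>k = Suc K\<close> flips the sign.\<close>
  have "C * M = C * ((- 1) ^ K * (- 1) ^ K) * M"
    by (simp add: sign)
  also have "\<dots> = (- 1) ^ K * (C * ((- 1) ^ K * M))"
    by (simp only: mult_ac)
  also have "(- 1) ^ K * M = trunc_pent k * E 1 - 1"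
    unfolding M_def k by (rule andrews_merca)
  also have "C * (trunc_pent k * E 1 - 1) = trunc_pent k * U - C"
    unfolding U_def gf_unimodal_count[OF assms(3)] C_def[symmetric] by (simp add: algebra_simps)
  also have "(- 1) ^ K * (trunc_pent k * U - C) = (- 1) ^ k * (C - trunc_pent k * U)"
    by (simp add: k algebra_simps)
  finally have "(C * M) $ n = ((- 1) ^ k * (C - trunc_pent k * U)) $ n" by simp
  also have "\<dots> = (- 1) ^ k * (C $ n - (trunc_pent k * U) $ n)"
    by (cases "even k") simp_all
  also have "(trunc_pent k * U) $ n = (\<Sum>j = 1 - int k..int k.
      (- 1) ^ nat \<bar>j\<bar> * int (unimodal_count m (int n - j * (3 * j - 1) div 2)))"
    unfolding U_def by (rule trunc_pent_mult_nth) (simp add: unimodal_count_def)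
  finally show ?thesis
    by (simp add: fps_mult_nth C_def M_def gf_mex_count[symmetric])
qed

end
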